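(* Suppose $\partial\Omega_1=\partial\Omega$ (so $\partial\Omega_2=\emptyset$) and the magnetic boundary condition is $\mathbf{B}\cdot\mathbf{n}|_{\partial\Omega}=g_1=0$. Then the space-discretized ideal compressible MHD equations consisting of the temperature-based hydrodynamic discretization together with the div-conforming magnetic field discretization (both written out in the context) conserve the total energy $$H(n,\mathbf{V},T,\mathbf{B})=\int_\Omega\left(\frac12m_in|\mathbf{V}|^2+\frac{nT}{\gamma-1}+\frac{|\mathbf{B}|^2}{2\mu_0}\right)dx,$$ i.e. $\frac{dH}{dt}=0$ along any solution.
   Context: $\Omega\subset\mathbb{R}^3$ is a bounded domain (possibly periodic, in which case boundary terms and conditions are absent) with a finite element mesh; $\mathbf{n}$ is the outward unit normal on $\partial\Omega$; $\langle\cdot,\cdot\rangle$ is the $L^2(\Omega)$ inner product, with derivatives of discontinuous fields taken cell-wise. $\mathbb{V}_0\subset H^1(\Omega)$, $\mathbb{V}_1\subset H(\mathrm{curl};\Omega)$, $\mathbb{V}_2\subset H(\mathrm{div};\Omega)$, $\mathbb{V}_3\subset L^2(\Omega)$ are finite-dimensional finite element spaces of cell-wise smooth functions forming a discrete de Rham complex: $\nabla\mathbb{V}_0\subset\mathbb{V}_1$, $\nabla\times\mathbb{V}_1\subset\mathbb{V}_2$, $\nabla\cdot\mathbb{V}_2\subset\mathbb{V}_3$, with constants in $\mathbb{V}_0$. $\mathring{\mathbb{V}}_2=\{\mathbf{w}\in\mathbb{V}_2:\mathbf{w}\cdot\mathbf{n}|_{\partial\Omega}=0\}$, $\mathring{\mathbb{V}}_1=\{\mathbf{\Sigma}\in\mathbb{V}_1:\mathbf{\Sigma}\times\mathbf{n}|_{\partial\Omega}=0\}$,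 and $\nabla\times\mathring{\mathbb{V}}_1\subset\mathring{\mathbb{V}}_2$. $\Gamma$ is the set of interior mesh facets, whose two sides are arbitrarily labelled $+,-$, with unit facet normals $\mathbf{n}^+=-\mathbf{n}^-$. For scalars $\psi$: $[\![\psi]\!]=\psi^+-\psi^-$, $\{\psi\}=\frac12(\psi^++\psi^-)$. For vector fields $\mathbf{u}$: $\{\mathbf{u}\}=\frac12(\mathbf{u}^+\cdot\mathbf{n}^+-\mathbf{u}^-\cdot\mathbf{n}^-)$, $\{\!\{\mathbf{n}\times\mathbf{u}\}\!\}=\mathbf{n}^+\times\mathbf{u}^++\mathbf{n}^-\times\mathbf{u}^-$, and the upwind value is $\tilde{\mathbf{u}}=\mathbf{u}^+$ if $\mathbf{u}^+\cdot\mathbf{n}^+<0$ and $\tilde{\mathbf{u}}=\mathbf{u}^-$ otherwise. $h_e$ is the local facet area, $\kappa_T$ a stabilization parameter, $m_i,\mu_0>0$ and $\gamma=5/3$ constants. Temperature-based hydrodynamic discretization: time-differentiable $(n,\mathbf{V},T)\in(\mathbb{V}_3,\mathring{\mathbb{V}}_2,\mathbb{V}_0)$, $n>0$, with $$\frac{\partial n}{\partial t}+\nabla\cdot\mathbf{F}=0,$$ $$\Big\langle\mathbf{w},\frac{\partial\mathbf{V}}{\partial t}\Big\rangle+\langle\nabla\times(\mathbf{w}\times\mathbf{F}/n),\mathbf{V}\rangle-\int_\Gamma\{\!\{\mathbf{n}\times(\mathbf{w}\times\mathbf{F}/n)\}\!\}\cdot\tilde{\mathbf{V}}\,dS-\Big\langle\frac12|\mathbf{V}|^2,\nabla\cdot\mathbf{w}\Big\rangle+\Big\langle\mathbf{j},\frac{\mathbf{w}}{m_in}\times\mathbf{B}\Big\rangle+\Big\langle\frac{\mathbf{w}}{m_in},\nabla(nT)\Big\rangle-\int_\Gamma[\![nT]\!]\Big\{\frac{\mathbf{w}}{m_in}\Big\}dS=0\quad\forall\mathbf{w}\in\mathring{\mathbb{V}}_2,$$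 $$\Big\langle\frac{n\chi}{\gamma-1},\frac{\partial T}{\partial t}\Big\rangle+\Big\langle\frac{\chi}{\gamma-1}\mathbf{F},\nabla T\Big\rangle+\int_\Gamma\frac{h_e^2\kappa_T}{(\gamma-1)\{n\}}[\![\mathbf{F}\cdot\nabla\chi]\!][\![\mathbf{F}\cdot\nabla T]\!]dS-\langle\mathbf{F}/n,\nabla(\chi nT)\rangle+\int_\Gamma[\![\chi nT]\!]\{\mathbf{F}/n\}dS=0\quad\forall\chi\in\mathbb{V}_0,$$ where $\mathbf{F}\in\mathring{\mathbb{V}}_2$ is defined by $\langle\mathbf{w},\mathbf{F}-n\mathbf{V}\rangle=0$ for all $\mathbf{w}\in\mathring{\mathbb{V}}_2$. Div-conforming magnetic field discretization (for $g_1=0$ on $\partial\Omega_1=\partial\Omega$, imposed strongly): time-differentiable $\mathbf{B}\in\mathring{\mathbb{V}}_2$ and $\mathbf{E},\mathbf{j}\in\mathring{\mathbb{V}}_1$ with $$\frac{\partial\mathbf{B}}{\partial t}+\nabla\times\mathbf{E}=0,\qquad\langle\mathbf{\Sigma},\mathbf{E}+\mathbf{F}/n\times\mathbf{B}\rangle=0,\qquad\langle\mathbf{\Sigma},\mathbf{j}\rangle=\Big\langle\nabla\times\mathbf{\Sigma},\frac1{\mu_0}\mathbf{B}\Big\rangle\qquad\forall\mathbf{\Sigma}\in\mathring{\mathbb{V}}_1.$$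
   Formalization: The kinetic energy density is taken as ½ m_i n|V|² instead of the printed ½ m_i|V|²; without the factor n the functional is not conserved (by scaling n, F, B, E, j, the integral of |V|² alone would have to be constant). *)

theory Defs
  imports "HOL-Analysis.Analysis"
begin

unbundle cross3_syntax

type_synonym R3 = "real^3"
type_synonym sfield = "R3 \<Rightarrow> real"
type_synonym vfield = "R3 \<Rightarrow> R3"


section \<open>Smooth functions and classical first-order operators\<close>

text \<open>Intended for open \<open>U\<close> and finite-dimensional domains, where it is the usual \<open>C\<^sup>k\<close>.\<close>

primrec Ck_on :: "nat \<Rightarrow> R3 set \<Rightarrow> (R3 \<Rightarrow> 'b::real_normed_vector) \<Rightarrow> bool" where
  "Ck_on 0 U f \<longleftrightarrow> continuous_on U f"
| "Ck_on (Suc k) U f \<longleftrightarrow>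
     (\<forall>x\<in>U. f differentiable (at x)) \<and> (\<forall>v. Ck_on k U (\<lambda>x. frechet_derivative f (at x) v))"

definition smooth_on :: "R3 set \<Rightarrow> (R3 \<Rightarrow> 'b::real_normed_vector) \<Rightarrow> bool" where
  "smooth_on U f \<longleftrightarrow> (\<forall>k. Ck_on k U f)"

definition pd :: "3 \<Rightarrow> (R3 \<Rightarrow> 'b::real_normed_vector) \<Rightarrow> R3 \<Rightarrow> 'b" where
  "pd i f x = frechet_derivative f (at x) (axis i 1)"


section \<open>Surface measure\<close>

text \<open>Two-dimensional Hausdorff (outer) measure on \<open>\<real>\<^sup>3\<close>; the factor \<open>pi/4\<close> normalises it to
  surface area. It is a metric outer measure, hence countably additive on the Borel sets, so
  \<open>surface_measure\<close> is not the degenerate case of \<^const>\<open>measure_of\<close>.\<close>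

definition hausdorff2 :: "R3 set \<Rightarrow> ennreal" where
  "hausdorff2 A =
     (SUP \<delta>\<in>{0<..}. INF C\<in>{C :: nat \<Rightarrow> R3 set.
          A \<subseteq> (\<Union>i. C i) \<and> (\<forall>i. bounded (C i) \<and> diameter (C i) \<le> (\<delta>::real))}.
        (\<Sum>i. ennreal (pi / 4 * (diameter (C i))\<^sup>2)))"

definition surface_measure :: "R3 measure" where
  "surface_measure = measure_of UNIV (sets borel) hausdorff2"


section \<open>Meshes\<close>

text \<open>\<open>\<nu>\<close> is the outward unit normal of \<open>K\<close> at \<open>x\<close>, a point at which the boundary of \<open>K\<close> is
  \<open>C\<^sup>1\<close>: near \<open>x\<close> the set \<open>K\<close> is the sublevel set of a \<open>C\<^sup>1\<close> function whose gradient at \<open>x\<close> is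
  a positive multiple of \<open>\<nu>\<close>.\<close>

definition outward_normal :: "R3 set \<Rightarrow> R3 \<Rightarrow> R3 \<Rightarrow> bool" where
  "outward_normal K x \<nu> \<longleftrightarrow> norm \<nu> = 1 \<and> x \<in> frontier K \<and>
     (\<exists>U g c. open U \<and> x \<in> U \<and> Ck_on 1 U (g :: R3 \<Rightarrow> real) \<and> K \<inter> U = {y\<in>U. g y < 0} \<and>
        0 < c \<and> (g has_derivative (\<lambda>h. c * (\<nu> \<bullet> h))) (at x))"

text \<open>A (possibly periodic) domain with its mesh. \<open>periods\<close> is the group of period vectors:
  \<open>{0}\<close> for an ordinary domain, in which case \<open>domain\<close> is the bounded domain \<open>\<Omega>\<close> itself. In the
  periodic case \<open>domain\<close> is the unrolled (translation invariant) domain, and \<open>\<Omega>\<close> is its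
  quotient by \<open>periods\<close>. The cells are open sets; they and their translates tile \<open>domain\<close>,
  so \<open>cells\<close> covers \<open>\<Omega>\<close> exactly once up to a null set.

  A facet \<open>e\<close> lies on the boundary of \<open>plus_cell e\<close>, and its translate by the period
  \<open>shift e\<close> lies on the boundary of \<open>minus_cell e\<close>; the shift is zero except for facets
  that are glued by periodicity. Which side is called plus is arbitrary.\<close>

record facet =
  face :: "R3 set"
  plus_cell :: "R3 set"
  minus_cell :: "R3 set"
  shift :: R3

record mesh =
  periods :: "R3 set"
  domain :: "R3 set"
  cells :: "R3 set set"
  facets :: "facet set"

abbreviation translate :: "R3 \<Rightarrow> R3 set \<Rightarrow> R3 set" where
  "translate p A \<equiv> (\<lambda>x. p + x) ` A"

definition fe_mesh :: "mesh \<Rightarrow> bool" where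
  "fe_mesh M \<longleftrightarrow>
     \<comment> \<open>domain\<close>
     0 \<in> periods M \<and> (\<forall>p\<in>periods M. \<forall>q\<in>periods M. p - q \<in> periods M) \<and>
     open (domain M) \<and> connected (domain M) \<and> domain M \<noteq> {} \<and>
     (\<forall>p\<in>periods M. translate p (domain M) = domain M) \<and>
     \<comment> \<open>cells\<close>
     finite (cells M) \<and>
     (\<forall>K\<in>cells M. open K \<and> connected K \<and> K \<noteq> {} \<and> bounded K \<and> negligible (frontier K)
        \<and> K \<subseteq> domain M) \<and>
     (\<forall>K\<in>cells M. \<forall>L\<in>cells M. \<forall>p\<in>periods M.
        K \<noteq> L \<or> p \<noteq> 0 \<longrightarrow> K \<inter> translate p L = {}) \<and>
     domain M \<subseteq> (\<Union>K\<in>cells M. \<Union>p\<in>periods M. translate p (closure K)) \<and>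
     \<comment> \<open>interior facets\<close>
     finite (facets M) \<and>
     (\<forall>e\<in>facets M.
        plus_cell e \<in> cells M \<and> minus_cell e \<in> cells M \<and> shift e \<in> periods M \<and>
        face e \<noteq> {} \<and> connected (face e) \<and> face e \<subseteq> domain M \<and>
        face e \<in> sets borel \<and> hausdorff2 (face e) < \<infinity> \<and>
        (\<forall>x\<in>face e. \<exists>\<nu>. outward_normal (plus_cell e) x \<nu> \<and>
            outward_normal (minus_cell e) (x + shift e) (- \<nu>))) \<and>
     (\<forall>e\<in>facets M. \<forall>e'\<in>facets M. \<forall>p\<in>periods M.
        e \<noteq> e' \<or> p \<noteq> 0 \<longrightarrow> face e \<inter> translate p (face e') = {}) \<and>
     (\<forall>K\<in>cells M. hausdorff2 (frontier K \<inter> domain M -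
        (\<Union>e\<in>facets M. \<Union>p\<in>periods M. translate p (face e))) = 0)"

definition Om :: "mesh \<Rightarrow> R3 set" where
  "Om M = \<Union> (cells M)"


section \<open>Inner products, cell-wise derivatives and weak derivatives\<close>

definition ip :: "mesh \<Rightarrow> (R3 \<Rightarrow> 'a::euclidean_space) \<Rightarrow> (R3 \<Rightarrow> 'a) \<Rightarrow> real" where
  "ip M f g = (LINT x:Om M|lborel. f x \<bullet> g x)"

text \<open>Cell-wise derivatives; like all discrete fields below they are set to zero off the open
  cells, i.e. on a null set of \<open>\<Omega>\<close>.\<close>

definition gradh :: "mesh \<Rightarrow> sfield \<Rightarrow> vfield" where
  "gradh M \<psi> x = (if x \<in> Om M then (\<chi> i. pd i \<psi> x) else 0)"

definition divh :: "mesh \<Rightarrow> vfield \<Rightarrow> sfield" where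
  "divh M u x = (if x \<in> Om M then (\<Sum>i\<in>UNIV. pd i u x $ i) else 0)"

definition curlh :: "mesh \<Rightarrow> vfield \<Rightarrow> vfield" where
  "curlh M u x = (if x \<in> Om M then
     vector [pd 2 u x $ 3 - pd 3 u x $ 2,
             pd 3 u x $ 1 - pd 1 u x $ 3,
             pd 1 u x $ 2 - pd 2 u x $ 1] else 0)"

definition L2 :: "mesh \<Rightarrow> (R3 \<Rightarrow> 'a::euclidean_space) set" where
  "L2 M = {u. set_borel_measurable lborel (Om M) u \<and>
              set_integrable lborel (Om M) (\<lambda>x. (norm (u x))\<^sup>2)}"

text \<open>Test functions on \<open>\<Omega>\<close>: smooth, periodic, and supported away from the boundary. The
  support is compact modulo the periods since the domain is bounded modulo the periods.\<close>

definition test_fun :: "mesh \<Rightarrow> (R3 \<Rightarrow> 'a::euclidean_space) \<Rightarrow> bool" where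
  "test_fun M \<phi> \<longleftrightarrow> smooth_on UNIV \<phi> \<and> (\<forall>p\<in>periods M. \<forall>x. \<phi> (x + p) = \<phi> x) \<and>
     closure {x. \<phi> x \<noteq> 0} \<subseteq> domain M"

definition weak_grad :: "mesh \<Rightarrow> sfield \<Rightarrow> vfield \<Rightarrow> bool" where
  "weak_grad M u g \<longleftrightarrow> g \<in> L2 M \<and> (\<forall>\<phi>. test_fun M \<phi> \<longrightarrow> ip M u (divh M \<phi>) = - ip M g \<phi>)"

definition weak_div :: "mesh \<Rightarrow> vfield \<Rightarrow> sfield \<Rightarrow> bool" where
  "weak_div M u d \<longleftrightarrow> d \<in> L2 M \<and> (\<forall>\<phi>. test_fun M \<phi> \<longrightarrow> ip M u (gradh M \<phi>) = - ip M d \<phi>)"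

definition weak_curl :: "mesh \<Rightarrow> vfield \<Rightarrow> vfield \<Rightarrow> bool" where
  "weak_curl M u c \<longleftrightarrow> c \<in> L2 M \<and> (\<forall>\<phi>. test_fun M \<phi> \<longrightarrow> ip M u (curlh M \<phi>) = ip M c \<phi>)"

definition H1 :: "mesh \<Rightarrow> sfield set" where
  "H1 M = {u \<in> L2 M. \<exists>g. weak_grad M u g}"

definition Hdiv :: "mesh \<Rightarrow> vfield set" where
  "Hdiv M = {u \<in> L2 M. \<exists>d. weak_div M u d}"

definition Hcurl :: "mesh \<Rightarrow> vfield set" where
  "Hcurl M = {u \<in> L2 M. \<exists>c. weak_curl M u c}"

text \<open>Boundary traces. For \<open>w \<in> H(div)\<close> the normal trace \<open>w \<cdot> n\<close> on the boundary is the
  functional \<open>\<phi> \<mapsto> \<langle>w, grad \<phi>\<rangle> + \<langle>div w, \<phi>\<rangle>\<close> on \<open>H\<^sup>1\<close>, and for \<open>S \<in> H(curl)\<close> the tangential trace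
  \<open>S \<times> n\<close> is the functional \<open>\<phi> \<mapsto> \<langle>S, curl \<phi>\<rangle> - \<langle>curl S, \<phi>\<rangle>\<close> on \<open>(H\<^sup>1)\<^sup>3\<close>; weak derivatives are
  unique almost everywhere. No regularity of the boundary is needed, and the conditions hold
  automatically where periodicity leaves no boundary.\<close>

definition zero_normal_trace :: "mesh \<Rightarrow> vfield \<Rightarrow> bool" where
  "zero_normal_trace M w \<longleftrightarrow>
     (\<forall>d \<phi> g. weak_div M w d \<and> \<phi> \<in> H1 M \<and> weak_grad M \<phi> g \<longrightarrow> ip M w g + ip M d \<phi> = 0)"

definition zero_tangential_trace :: "mesh \<Rightarrow> vfield \<Rightarrow> bool" where
  "zero_tangential_trace M S \<longleftrightarrow>
     (\<forall>c \<phi> k. weak_curl M S c \<and> (\<forall>i. (\<lambda>x. \<phi> x $ i) \<in> H1 M) \<and> weak_curl M \<phi> k \<longrightarrow>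
        ip M S k - ip M c \<phi> = 0)"


section \<open>Finite element spaces\<close>

text \<open>Smoothness on a cell is up to its boundary, so that one-sided traces exist.\<close>

definition cellwise_smooth :: "mesh \<Rightarrow> (R3 \<Rightarrow> 'a::euclidean_space) \<Rightarrow> bool" where
  "cellwise_smooth M u \<longleftrightarrow>
     (\<forall>K\<in>cells M. \<exists>U g. open U \<and> closure K \<subseteq> U \<and> smooth_on U g \<and> (\<forall>x\<in>K. u x = g x))"

definition fe_space :: "mesh \<Rightarrow> (R3 \<Rightarrow> 'a::euclidean_space) set \<Rightarrow> bool" where
  "fe_space M V \<longleftrightarrow> (\<exists>(N::nat) b.
     (\<forall>i<N. cellwise_smooth M (b i) \<and> (\<forall>x. x \<notin> Om M \<longrightarrow> b i x = 0)) \<and>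
     V = {(\<lambda>x. \<Sum>i<N. c i *\<^sub>R b i x) | c :: nat \<Rightarrow> real. True})"

definition ring1 :: "mesh \<Rightarrow> vfield set \<Rightarrow> vfield set" where
  "ring1 M V1 = {S \<in> V1. zero_tangential_trace M S}"

definition ring2 :: "mesh \<Rightarrow> vfield set \<Rightarrow> vfield set" where
  "ring2 M V2 = {w \<in> V2. zero_normal_trace M w}"

definition discrete_de_Rham ::
  "mesh \<Rightarrow> sfield set \<Rightarrow> vfield set \<Rightarrow> vfield set \<Rightarrow> sfield set \<Rightarrow> bool" where
  "discrete_de_Rham M V0 V1 V2 V3 \<longleftrightarrow>
     fe_space M V0 \<and> fe_space M V1 \<and> fe_space M V2 \<and> fe_space M V3 \<and>
     V0 \<subseteq> H1 M \<and> V1 \<subseteq> Hcurl M \<and> V2 \<subseteq> Hdiv M \<and> V3 \<subseteq> L2 M \<and>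
     gradh M ` V0 \<subseteq> V1 \<and> curlh M ` V1 \<subseteq> V2 \<and> divh M ` V2 \<subseteq> V3 \<and>
     (\<forall>c. (\<lambda>x. if x \<in> Om M then c else 0) \<in> V0) \<and>
     curlh M ` ring1 M V1 \<subseteq> ring2 M V2"


section \<open>Facet terms\<close>

definition cell_trace :: "R3 set \<Rightarrow> (R3 \<Rightarrow> 'a::euclidean_space) \<Rightarrow> R3 \<Rightarrow> 'a" where
  "cell_trace K u x = Lim (at x within K) u"

definition trp :: "facet \<Rightarrow> (R3 \<Rightarrow> 'a::euclidean_space) \<Rightarrow> R3 \<Rightarrow> 'a" where
  "trp e u x = cell_trace (plus_cell e) u x"

definition trm :: "facet \<Rightarrow> (R3 \<Rightarrow> 'a::euclidean_space) \<Rightarrow> R3 \<Rightarrow> 'a" where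
  "trm e u x = cell_trace (minus_cell e) u (x + shift e)"

definition nrp :: "facet \<Rightarrow> R3 \<Rightarrow> R3" where
  "nrp e x = (THE \<nu>. outward_normal (plus_cell e) x \<nu>)"

definition nrm :: "facet \<Rightarrow> R3 \<Rightarrow> R3" where
  "nrm e x = (THE \<nu>. outward_normal (minus_cell e) (x + shift e) \<nu>)"

definition jump :: "facet \<Rightarrow> sfield \<Rightarrow> R3 \<Rightarrow> real" where
  "jump e \<psi> x = trp e \<psi> x - trm e \<psi> x"

definition avg :: "facet \<Rightarrow> sfield \<Rightarrow> R3 \<Rightarrow> real" where
  "avg e \<psi> x = (trp e \<psi> x + trm e \<psi> x) / 2"

definition avg_normal :: "facet \<Rightarrow> vfield \<Rightarrow> R3 \<Rightarrow> real" where
  "avg_normal e u x = (trp e u x \<bullet> nrp e x - trm e u x \<bullet> nrm e x) / 2"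

definition jump_cross :: "facet \<Rightarrow> vfield \<Rightarrow> R3 \<Rightarrow> R3" where
  "jump_cross e u x = nrp e x \<times> trp e u x + nrm e x \<times> trm e u x"

definition upwind :: "facet \<Rightarrow> vfield \<Rightarrow> R3 \<Rightarrow> R3" where
  "upwind e u x = (if trp e u x \<bullet> nrp e x < 0 then trp e u x else trm e u x)"

definition facet_area :: "facet \<Rightarrow> real" where
  "facet_area e = measure surface_measure (face e)"

definition int_Gamma :: "mesh \<Rightarrow> (facet \<Rightarrow> R3 \<Rightarrow> real) \<Rightarrow> real" where
  "int_Gamma M f = (\<Sum>e\<in>facets M. LINT x:face e|surface_measure. f e x)"


section \<open>The semi-discrete equations\<close>

definition adiabatic_index :: real ("\<gamma>") where
  "\<gamma> = 5 / 3"

text \<open>In a finite-dimensional space of functions, differentiability of a curve is the same as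
  pointwise differentiability.\<close>

definition time_differentiable ::
  "mesh \<Rightarrow> real set \<Rightarrow> (real \<Rightarrow> R3 \<Rightarrow> 'a::euclidean_space) \<Rightarrow> bool" where
  "time_differentiable M I u \<longleftrightarrow>
     (\<forall>t\<in>I. \<forall>x\<in>Om M. (\<lambda>s. u s x) differentiable (at t within I))"

definition ddt :: "real set \<Rightarrow> (real \<Rightarrow> R3 \<Rightarrow> 'a::euclidean_space) \<Rightarrow> real \<Rightarrow> R3 \<Rightarrow> 'a" where
  "ddt I u t x = vector_derivative (\<lambda>s. u s x) (at t within I)"

definition flux_eq :: "mesh \<Rightarrow> vfield set \<Rightarrow> sfield \<Rightarrow> vfield \<Rightarrow> vfield \<Rightarrow> bool" where
  "flux_eq M V2 n V F \<longleftrightarrow> F \<in> ring2 M V2 \<and>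
     (\<forall>w\<in>ring2 M V2. ip M w (\<lambda>x. F x - n x *\<^sub>R V x) = 0)"

definition momentum_eq ::
  "mesh \<Rightarrow> vfield set \<Rightarrow> real \<Rightarrow> sfield \<Rightarrow> vfield \<Rightarrow> vfield \<Rightarrow> sfield \<Rightarrow> vfield \<Rightarrow> vfield \<Rightarrow> vfield
     \<Rightarrow> bool" where
  "momentum_eq M V2 mi n V V_t T F B j \<longleftrightarrow> (\<forall>w\<in>ring2 M V2.
     ip M w V_t
     + ip M (curlh M (\<lambda>x. w x \<times> (F x /\<^sub>R n x))) V
     - int_Gamma M (\<lambda>e x. jump_cross e (\<lambda>y. w y \<times> (F y /\<^sub>R n y)) x \<bullet> upwind e V x)
     - ip M (\<lambda>x. 1 / 2 * (norm (V x))\<^sup>2) (divh M w)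
     + ip M j (\<lambda>x. (w x /\<^sub>R (mi * n x)) \<times> B x)
     + ip M (\<lambda>x. w x /\<^sub>R (mi * n x)) (gradh M (\<lambda>x. n x * T x))
     - int_Gamma M (\<lambda>e x. jump e (\<lambda>y. n y * T y) x * avg_normal e (\<lambda>y. w y /\<^sub>R (mi * n y)) x)
     = 0)"

definition temperature_eq ::
  "mesh \<Rightarrow> sfield set \<Rightarrow> real \<Rightarrow> sfield \<Rightarrow> sfield \<Rightarrow> sfield \<Rightarrow> vfield \<Rightarrow> bool" where
  "temperature_eq M V0 \<kappa> n T T_t F \<longleftrightarrow> (\<forall>q\<in>V0.
     ip M (\<lambda>x. n x * q x / (\<gamma> - 1)) T_t
     + ip M (\<lambda>x. (q x / (\<gamma> - 1)) *\<^sub>R F x) (gradh M T)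
     + int_Gamma M (\<lambda>e x. (facet_area e)\<^sup>2 * \<kappa> / ((\<gamma> - 1) * avg e n x)
          * jump e (\<lambda>y. F y \<bullet> gradh M q y) x * jump e (\<lambda>y. F y \<bullet> gradh M T y) x)
     - ip M (\<lambda>x. F x /\<^sub>R n x) (gradh M (\<lambda>x. q x * n x * T x))
     + int_Gamma M (\<lambda>e x. jump e (\<lambda>y. q y * n y * T y) x * avg_normal e (\<lambda>y. F y /\<^sub>R n y) x)
     = 0)"

text \<open>Positivity of \<open>n\<close> is required up to the boundary of each cell, since the facet terms divide
  by the one-sided values of \<open>n\<close>.\<close>

definition hydro_solution ::
  "mesh \<Rightarrow> sfield set \<Rightarrow> vfield set \<Rightarrow> sfield set \<Rightarrow> real \<Rightarrow> real \<Rightarrow> real set \<Rightarrow>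
   (real \<Rightarrow> sfield) \<Rightarrow> (real \<Rightarrow> vfield) \<Rightarrow> (real \<Rightarrow> sfield) \<Rightarrow> (real \<Rightarrow> vfield) \<Rightarrow>
   (real \<Rightarrow> vfield) \<Rightarrow> (real \<Rightarrow> vfield) \<Rightarrow> bool" where
  "hydro_solution M V0 V2 V3 \<kappa> mi I n V T F B j \<longleftrightarrow>
     time_differentiable M I n \<and> time_differentiable M I V \<and> time_differentiable M I T \<and>
     (\<forall>t\<in>I.
        n t \<in> V3 \<and> V t \<in> ring2 M V2 \<and> T t \<in> V0 \<and>
        (\<forall>K\<in>cells M. \<forall>x\<in>closure K. 0 < cell_trace K (n t) x) \<and>
        flux_eq M V2 (n t) (V t) (F t) \<and>
        (\<forall>x\<in>Om M. ddt I n t x + divh M (F t) x = 0) \<and>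
        momentum_eq M V2 mi (n t) (V t) (ddt I V t) (T t) (F t) (B t) (j t) \<and>
        temperature_eq M V0 \<kappa> (n t) (T t) (ddt I T t) (F t))"

definition magnetic_solution ::
  "mesh \<Rightarrow> vfield set \<Rightarrow> vfield set \<Rightarrow> real \<Rightarrow> real set \<Rightarrow> (real \<Rightarrow> sfield) \<Rightarrow>
   (real \<Rightarrow> vfield) \<Rightarrow> (real \<Rightarrow> vfield) \<Rightarrow> (real \<Rightarrow> vfield) \<Rightarrow> (real \<Rightarrow> vfield) \<Rightarrow> bool" where
  "magnetic_solution M V1 V2 mu0 I n F B E j \<longleftrightarrow>
     time_differentiable M I B \<and>
     (\<forall>t\<in>I.
        B t \<in> ring2 M V2 \<and> E t \<in> ring1 M V1 \<and> j t \<in> ring1 M V1 \<and>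
        (\<forall>x\<in>Om M. ddt I B t x + curlh M (E t) x = 0) \<and>
        (\<forall>S\<in>ring1 M V1. ip M S (\<lambda>x. E t x + (F t x /\<^sub>R n t x) \<times> B t x) = 0) \<and>
        (\<forall>S\<in>ring1 M V1. ip M S (j t) = ip M (curlh M S) (\<lambda>x. (1 / mu0) *\<^sub>R B t x)))"

text \<open>The kinetic energy density is \<open>m\<^sub>i n |V|\<^sup>2 / 2\<close>. Without the factor \<open>n\<close> the functional is not
  conserved: the equations are invariant under \<open>(n, F, B, E, j) \<mapsto> (s n, s F, \<surd>s B, \<surd>s E, \<surd>s j)\<close> for
  \<open>s > 0\<close>, so the integral of \<open>|V|\<^sup>2\<close> would have to be conserved on its own.\<close>

definition energy ::
  "mesh \<Rightarrow> real \<Rightarrow> real \<Rightarrow> sfield \<Rightarrow> vfield \<Rightarrow> sfield \<Rightarrow> vfield \<Rightarrow> real" where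
  "energy M mi mu0 n V T B =
     (LINT x:Om M|lborel. 1 / 2 * mi * n x * (norm (V x))\<^sup>2 + n x * T x / (\<gamma> - 1)
        + (norm (B x))\<^sup>2 / (2 * mu0))"

end

theory Submission
  imports Defs "HOL-Computational_Algebra.Polynomial"
begin

text \<open>
  The energy law is the sum of the discrete equations with suitable test functions. At a fixed time
  put \<open>w = m\<^sub>i F\<close> in the momentum equation and \<open>\<chi> = 1\<close> in the temperature equation. The vorticity
  terms vanish because \<open>F \<times> F/n = 0\<close>, the stabilisation vanishes because \<open>\<nabla>1 = 0\<close>, and the pressure
  terms \<open>\<langle>F/n, \<nabla>(nT)\<rangle>\<close> of both equations, with their facet corrections, have opposite signs and
  cancel in the sum. Ohm's law tested with \<open>j\<close> and Ampere's law tested with \<open>E\<close> turn the work of the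
  Lorentz force, \<open>\<langle>j, F/n \<times> B\<rangle>\<close>, into \<open>- \<langle>\<nabla> \<times> E, B\<rangle>/\<mu>\<^sub>0\<close>, the rate of change of the magnetic energy.
  The flux equation tested with \<open>\<partial>V/\<partial>t\<close> replaces \<open>\<langle>F, \<partial>V/\<partial>t\<rangle>\<close> by \<open>\<langle>nV, \<partial>V/\<partial>t\<rangle>\<close>. With
  \<open>\<partial>n/\<partial>t = - \<nabla> \<cdot> F\<close>, all that is left of \<open>dH/dt\<close> is \<open>- (\<langle>F, \<nabla>T\<rangle> + \<langle>\<nabla> \<cdot> F, T\<rangle>)/(\<gamma> - 1)\<close>, and this is
  zero since \<open>F\<close> has no normal trace.

  Two of these steps are more than algebra.

  One is the last step (\<open>zero_normal_trace_green\<close>). The trace condition speaks about weak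
  derivatives of \<open>T\<close> and \<open>F\<close>, whereas the equations contain the cell-wise ones. The two kinds are
  compared in the pairings that occur (\<open>ip_weak_grad\<close>, \<open>ip_weak_div\<close>): the fields are multiplied by
  smooth cutoffs that are supported inside the cells and tend to 1 on them (\<open>smooth_cutoffs\<close>); the
  products become test functions after periodic continuation (\<open>test_fun_extension\<close>), and integration
  by parts for compactly supported functions (\<open>integral_pd_zero\<close>) applies to them.

  The other is the use of \<open>\<partial>V/\<partial>t\<close> as a test function, along with differentiation under the integral
  sign. A finite-dimensional space of functions has coordinates that are combinations of point
  values (\<open>interpolation_exists\<close>), so a curve in it that is differentiable at each point has
  differentiable coordinates. Hence its derivative stays in the space, and the energy is a polynomial
  in finitely many differentiable functions of time (\<open>ddt_in_space\<close>, \<open>field_curve_integral\<close>).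
\<close>

section \<open>Calculus of \<open>C\<^sup>k\<close> functions\<close>

lemma differentiable_transform_open:
  assumes "f differentiable (at x)" "open U" "x \<in> U" "\<And>y. y \<in> U \<Longrightarrow> f y = g y"
  shows "g differentiable (at x)"
  using assms has_derivative_transform_within_open[of f _ x UNIV U g]
  unfolding differentiable_def by auto

lemma Ck_on_cong:
  assumes "open U" "\<And>x. x \<in> U \<Longrightarrow> f x = g x" "Ck_on k U f"
  shows "Ck_on k U g"
  using assms(2,3)
proof (induction k arbitrary: f g)
  case 0
  then show ?case by (simp cong: continuous_on_cong)
next
  case (Suc k)
  have diff: "f differentiable (at x)" if "x \<in> U" for x
    using Suc.prems(2) that by simp
  have "g differentiable (at x)" if "x \<in> U" for x
    using differentiable_transform_open[OF diff[OF that] assms(1) that] Suc.prems(1) by blast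
  moreover have "Ck_on k U (\<lambda>x. frechet_derivative g (at x) v)" for v
  proof (rule Suc.IH)
    show "frechet_derivative f (at x) v = frechet_derivative g (at x) v" if "x \<in> U" for x
      using frechet_derivative_transform_within_open[OF diff[OF that] assms(1) that Suc.prems(1)]
      by simp
    show "Ck_on k U (\<lambda>x. frechet_derivative f (at x) v)" using Suc.prems(2) by simp
  qed
  ultimately show ?case by simp
qed

text \<open>The recursive definition speaks about the Frechet derivative at every point of the space, so a formula
  for the derivative that is valid on \<open>U\<close> only can be used because \<open>U\<close> is open.\<close>

lemma Ck_on_SucI:
  assumes "open U" "\<And>x. x \<in> U \<Longrightarrow> (f has_derivative D x) (at x)" "\<And>v. Ck_on k U (\<lambda>x. D x v)"
  shows "Ck_on (Suc k) U f"
proof -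
  have "Ck_on k U (\<lambda>x. frechet_derivative f (at x) v)" for v
  proof (rule Ck_on_cong[OF assms(1) _ assms(3)[of v]])
    show "D x v = frechet_derivative f (at x) v" if "x \<in> U" for x
      using frechet_derivative_at[OF assms(2)[OF that]] by simp
  qed
  then show ?thesis using assms(2) by (auto simp: differentiable_def)
qed

lemma Ck_on_differentiable:
  "Ck_on (Suc k) U f \<Longrightarrow> x \<in> U \<Longrightarrow> (f has_derivative frechet_derivative f (at x)) (at x)"
  by (simp add: frechet_derivative_works)

lemma Ck_on_lower: "Ck_on (Suc k) U f \<Longrightarrow> Ck_on k U f"
proof (induction k arbitrary: f)
  case 0
  then show ?case
    by (auto intro!: continuous_at_imp_continuous_on differentiable_imp_continuous_within)
next
  case (Suc k)
  have "Ck_on (Suc k) U (\<lambda>x. frechet_derivative f (at x) v)" for v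
    using Suc.prems unfolding Ck_on.simps(2)[of "Suc k"] by blast
  then have "Ck_on k U (\<lambda>x. frechet_derivative f (at x) v)" for v by (rule Suc.IH)
  then show ?case using Suc.prems by simp
qed

lemma Ck_on_subset: "Ck_on k U f \<Longrightarrow> W \<subseteq> U \<Longrightarrow> Ck_on k W f"
  by (induction k arbitrary: f) (auto intro: continuous_on_subset)

lemma Ck_on_local:
  assumes "\<And>x. x \<in> U \<Longrightarrow> \<exists>W. open W \<and> x \<in> W \<and> Ck_on k W f"
  shows "Ck_on k U f"
  using assms
proof (induction k arbitrary: f)
  case 0
  have "isCont f x" if "x \<in> U" for x
    using 0[OF that] continuous_on_eq_continuous_at by (metis Ck_on.simps(1))
  then show ?case by (simp add: continuous_at_imp_continuous_on)
next
  case (Suc k)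
  have "f differentiable (at x)" if "x \<in> U" for x
    using Suc.prems[OF that] by auto
  moreover have "Ck_on k U (\<lambda>x. frechet_derivative f (at x) v)" for v
    using Suc.prems by (intro Suc.IH) (metis Ck_on.simps(2))
  ultimately show ?case by simp
qed

lemma Ck_on_const: "open U \<Longrightarrow> Ck_on k U (\<lambda>x. c)"
  by (induction k arbitrary: c) (auto intro!: Ck_on_SucI[where D="\<lambda>x v. 0"] simp del: Ck_on.simps(2))

lemma Ck_on_id: "open U \<Longrightarrow> Ck_on k U (\<lambda>x. x)"
  by (cases k) (auto intro!: Ck_on_SucI[where D="\<lambda>x v. v"] Ck_on_const has_derivative_ident
      simp del: Ck_on.simps(2))

lemma Ck_on_add:
  assumes "open U"
  shows "Ck_on k U f \<Longrightarrow> Ck_on k U g \<Longrightarrow> Ck_on k U (\<lambda>x. f x + g x)"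
proof (induction k arbitrary: f g)
  case 0
  then show ?case by (auto intro: continuous_intros)
next
  case (Suc k)
  show ?case
    by (rule Ck_on_SucI[OF assms has_derivative_add[OF Ck_on_differentiable[OF Suc.prems(1)]
            Ck_on_differentiable[OF Suc.prems(2)]] Suc.IH])
       (use Suc.prems in auto)
qed

lemma Ck_on_linear:
  assumes "open U" "bounded_linear L"
  shows "Ck_on k U f \<Longrightarrow> Ck_on k U (\<lambda>x. L (f x))"
proof (induction k arbitrary: f)
  case 0
  then show ?case using assms(2) by (auto intro: bounded_linear.continuous_on)
next
  case (Suc k)
  show ?case
    by (rule Ck_on_SucI[OF assms(1) bounded_linear.has_derivative[OF assms(2)
            Ck_on_differentiable[OF Suc.prems]] Suc.IH])
       (use Suc.prems in auto)
qed

lemma Ck_on_bilinear: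
  assumes "open U" "bounded_bilinear m"
  shows "Ck_on k U f \<Longrightarrow> Ck_on k U g \<Longrightarrow> Ck_on k U (\<lambda>x. m (f x) (g x))"
proof (induction k arbitrary: f g)
  case 0
  then show ?case using assms(2) by (auto intro: bounded_bilinear.continuous_on)
next
  case (Suc k)
  note lo = Suc.prems[THEN Ck_on_lower]
  show ?case
    by (rule Ck_on_SucI[OF assms(1) bounded_bilinear.FDERIV[OF assms(2)
            Ck_on_differentiable[OF Suc.prems(1)] Ck_on_differentiable[OF Suc.prems(2)]]
            Ck_on_add[OF assms(1) Suc.IH Suc.IH]])
       (use Suc.prems lo in auto)
qed

lemma Ck_on_translate:
  "Ck_on k U f \<Longrightarrow> open U \<Longrightarrow> Ck_on k {x. x + p \<in> U} (\<lambda>x. f (x + p))"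
proof (induction k arbitrary: f)
  case 0
  then show ?case by (auto intro!: continuous_on_compose2[of U f] continuous_intros)
next
  case (Suc k)
  have op: "open {x. x + p \<in> U}"
    using open_vimage[OF \<open>open U\<close>, of "\<lambda>x. x + p"] by (simp add: vimage_def continuous_intros)
  have D: "((\<lambda>x. f (x + p)) has_derivative (\<lambda>v. frechet_derivative f (at (x + p)) v)) (at x)"
    if "x \<in> {x. x + p \<in> U}" for x
  proof -
    have a: "((\<lambda>x. x + p) has_derivative (\<lambda>v. v)) (at x)"
      by (auto intro!: derivative_eq_intros)
    have b: "(f has_derivative frechet_derivative f (at (x + p))) (at (x + p))"
      using Ck_on_differentiable[OF Suc.prems(1)] that by blast
    show ?thesis using has_derivative_compose[OF a b] by simp
  qed
  show ?case
    by (rule Ck_on_SucI[OF op D Suc.IH]) (use Suc.prems in auto)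
qed

section \<open>Smooth cutoff functions\<close>

text \<open>The functions \<open>p(1/t) exp(-1/t)\<close>, extended by zero to \<open>t \<le> 0\<close>. They are considered for all polynomials
  \<open>p\<close> at once since this family, unlike \<open>exp(-1/t)\<close> alone, is closed under differentiation; then
  smoothness is an induction on the order.\<close>

definition bump :: "real poly \<Rightarrow> real \<Rightarrow> real" where
  "bump p t = (if t > 0 then poly p (1 / t) * exp (- (1 / t)) else 0)"

lemma poly_exp_tendsto_0: "((\<lambda>u. poly p u * exp (- u)) \<longlongrightarrow> (0::real)) at_top"
proof -
  have "((\<lambda>u. \<Sum>i\<le>degree p. coeff p i * (u ^ i / exp u)) \<longlongrightarrow> (\<Sum>i\<le>degree p. coeff p i * 0)) at_top"
    by (intro tendsto_sum tendsto_mult tendsto_const tendsto_power_div_exp_0)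
  then show ?thesis
    by (simp add: poly_altdef exp_minus field_simps sum_divide_distrib)
qed

lemma bump_has_derivative:
  "(bump p has_real_derivative bump ([:0, 0, 1:] * (p - pderiv p)) t) (at t)"
proof -
  consider "t < 0" | "t = 0" | "t > 0" by linarith
  then show ?thesis
  proof cases
    case 1
    have "((\<lambda>x. 0) has_real_derivative 0) (at t)" by simp
    then have "(bump p has_real_derivative 0) (at t)"
      by (rule has_field_derivative_transform_within_open[of _ _ _ "{..<0}"])
         (use 1 in \<open>auto simp: bump_def\<close>)
    then show ?thesis using 1 by (simp add: bump_def)
  next
    case 3
    have inv: "((\<lambda>t. 1 / t) has_real_derivative - (1 / t\<^sup>2)) (at t)"
      using 3 by (auto intro!: derivative_eq_intros simp: power2_eq_square)
    have "((\<lambda>t. poly p (1 / t) * exp (- (1 / t))) has_real_derivative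
        poly (pderiv p) (1 / t) * - (1 / t\<^sup>2) * exp (- (1 / t))
        + exp (- (1 / t)) * - (- (1 / t\<^sup>2)) * poly p (1 / t)) (at t)"
      by (rule DERIV_mult[OF DERIV_chain2[OF poly_DERIV inv]
            DERIV_chain2[OF DERIV_exp DERIV_minus[OF inv]]])
    moreover have "poly (pderiv p) (1 / t) * - (1 / t\<^sup>2) * exp (- (1 / t))
        + exp (- (1 / t)) * - (- (1 / t\<^sup>2)) * poly p (1 / t) = bump ([:0, 0, 1:] * (p - pderiv p)) t"
      using 3 by (simp add: bump_def power2_eq_square algebra_simps)
    ultimately have "((\<lambda>t. poly p (1 / t) * exp (- (1 / t))) has_real_derivative
       bump ([:0, 0, 1:] * (p - pderiv p)) t) (at t)" by simp
    then show ?thesis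
      by (rule has_field_derivative_transform_within_open[of _ _ _ "{0<..}"])
         (use 3 in \<open>auto simp: bump_def\<close>)
  next
    case 2
    have "((\<lambda>h. bump p h / h) \<longlongrightarrow> 0) (at_right 0)"
    proof -
      have "((\<lambda>h. poly (pCons 0 p) (inverse h) * exp (- inverse h)) \<longlongrightarrow> 0) (at_right (0::real))"
        by (rule filterlim_compose[OF poly_exp_tendsto_0 filterlim_inverse_at_top_right])
      moreover have "\<forall>\<^sub>F h in at_right 0.
          poly (pCons 0 p) (inverse h) * exp (- inverse h) = bump p h / h"
        using eventually_at_right_less[of "0::real"]
        by eventually_elim (simp add: bump_def divide_inverse)
      ultimately show ?thesis by (rule Lim_transform_eventually)
    qed
    moreover have "((\<lambda>h. bump p h / h) \<longlongrightarrow> 0) (at_left 0)"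
      by (rule tendsto_eventually) (auto simp: eventually_at_filter bump_def)
    ultimately have "((\<lambda>h. bump p h / h) \<longlongrightarrow> 0) (at 0)"
      by (simp add: filterlim_split_at)
    then show ?thesis using 2 by (simp add: DERIV_def bump_def)
  qed
qed

lemma Ck_on_bump:
  assumes "open U" 
  shows "Ck_on k U s \<Longrightarrow> Ck_on k U (\<lambda>x. bump p (s x))"
proof (induction k arbitrary: p)
  case 0
  have "continuous_on UNIV (bump p)"
    by (rule DERIV_continuous_on[OF has_field_derivative_at_within[OF bump_has_derivative]])
  then show ?case using 0 continuous_on_compose2[of UNIV "bump p" U s] by simp
next
  case (Suc k)
  have D: "((\<lambda>x. bump p (s x)) has_derivative
      (\<lambda>v. bump ([:0, 0, 1:] * (p - pderiv p)) (s x) * frechet_derivative s (at x) v)) (at x)"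
    if "x \<in> U" for x
    using has_derivative_compose[OF Ck_on_differentiable[OF Suc.prems that]
        bump_has_derivative[unfolded has_field_derivative_def]] by simp
  show ?case
    by (rule Ck_on_SucI[OF assms D Ck_on_bilinear[OF assms bounded_bilinear_mult Suc.IH[OF Ck_on_lower]]])
       (use Suc.prems in auto)
qed

lemma bump_1_bounds: "0 \<le> bump 1 t" "bump 1 t \<le> 1"
  by (auto simp: bump_def)

lemma bump_1_pos: "0 < bump 1 t \<longleftrightarrow> 0 < t"
  by (auto simp: bump_def)

text \<open>Countably many balls whose closures lie in \<open>U\<close> cover \<open>U\<close>. Let \<open>\<psi>\<^sub>i\<close> be smooth and positive exactly on the
  \<open>i\<close>-th ball. Then \<open>N (\<psi>\<^sub>0 + \<dots> + \<psi>\<^sub>N\<^sub>-\<^sub>1)\<close> has compact support in \<open>U\<close> and tends to infinity at every point of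
  \<open>U\<close>, so \<open>t \<mapsto> exp(-1/t)\<close> turns it into cutoffs that tend to 1.\<close>

lemma smooth_cutoffs:
  fixes U :: "R3 set"
  assumes "open U"
  obtains \<eta> :: "nat \<Rightarrow> R3 \<Rightarrow> real" where
    "\<And>N. smooth_on UNIV (\<eta> N)"
    "\<And>N. \<exists>C. compact C \<and> C \<subseteq> U \<and> (\<forall>x. x \<notin> C \<longrightarrow> \<eta> N x = 0)"
    "\<And>N x. \<bar>\<eta> N x\<bar> \<le> 1"
    "\<And>x. x \<in> U \<Longrightarrow> (\<lambda>N. \<eta> N x) \<longlonglongrightarrow> 1"
proof (cases "U = {}")
  case True
  show ?thesis
    by (rule that[of "\<lambda>_ _. 0"]) (use True in \<open>auto simp: smooth_on_def Ck_on_const\<close>)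
next
  case False
  define \<F> where "\<F> = {ball c r |c r. cball c r \<subseteq> U}"
  have "\<Union>\<F> = U"
  proof
    show "\<Union>\<F> \<subseteq> U" unfolding \<F>_def using ball_subset_cball by fast
    show "U \<subseteq> \<Union>\<F>"
    proof
      fix x assume "x \<in> U"
      then obtain r where "r > 0" "cball x r \<subseteq> U" using assms open_contains_cball by blast
      then show "x \<in> \<Union>\<F>" unfolding \<F>_def using centre_in_ball by blast
    qed
  qed
  moreover obtain \<G> where G: "\<G> \<subseteq> \<F>" "countable \<G>" "\<Union>\<G> = \<Union>\<F>"
    using Lindelof[of \<F>] unfolding \<F>_def by blast
  ultimately have ne: "\<G> \<noteq> {}" and UG: "\<Union>\<G> = U" using False by auto
  have "\<exists>c r. from_nat_into \<G> i = ball c r \<and> cball c r \<subseteq> U" for i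
    using from_nat_into[OF ne, of i] G(1) unfolding \<F>_def by blast
  then obtain c r where cr: "\<And>i. from_nat_into \<G> i = ball (c i) (r i)" "\<And>i. cball (c i) (r i) \<subseteq> U"
    by metis
  have cover: "\<exists>i. x \<in> ball (c i) (r i)" if "x \<in> U" for x
    using that UG cr(1) from_nat_into_surj[OF G(2)] by (metis UnionE)
  define \<psi> where "\<psi> i x = (if r i > 0 then bump 1 ((r i)\<^sup>2 - (x - c i) \<bullet> (x - c i)) else 0)" for i x
  define \<eta> where "\<eta> N x = bump 1 (real N * (\<Sum>i<N. \<psi> i x))" for N x
  have psi0: "0 \<le> \<psi> i x" for i x by (simp add: \<psi>_def bump_1_bounds)
  have psi_pos: "0 < \<psi> i x" if "x \<in> ball (c i) (r i)" for i x
  proof -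
    have "norm (x - c i) < r i" using that by (simp add: dist_norm norm_minus_commute)
    moreover from this have "r i > 0" using norm_ge_zero le_less_trans by blast
    ultimately show ?thesis
      by (simp add: \<psi>_def bump_1_pos power2_norm_eq_inner[symmetric] power_strict_mono)
  qed
  have psi_out: "\<psi> i x = 0" if "x \<notin> cball (c i) (r i)" for i x
  proof -
    have "\<not> norm (x - c i) \<le> r i" using that by (simp add: dist_norm norm_minus_commute)
    then have "r i > 0 \<Longrightarrow> (r i)\<^sup>2 \<le> (norm (x - c i))\<^sup>2" by (intro power_mono) auto
    then show ?thesis by (auto simp: \<psi>_def bump_def power2_norm_eq_inner)
  qed
  have psi_smooth: "Ck_on k UNIV (\<psi> i)" for k i
  proof (cases "r i > 0")
    case True
    have 1: "Ck_on k UNIV (\<lambda>x. x + - c i)"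
      by (intro Ck_on_add Ck_on_id Ck_on_const open_UNIV)
    have 2: "Ck_on k UNIV (\<lambda>x. - ((x + - c i) \<bullet> (x + - c i)))"
      by (rule Ck_on_linear[OF open_UNIV bounded_linear_minus[OF bounded_linear_ident]
            Ck_on_bilinear[OF open_UNIV bounded_bilinear_inner 1 1]])
    have "Ck_on k UNIV (\<lambda>x. bump 1 ((r i)\<^sup>2 + - ((x + - c i) \<bullet> (x + - c i))))"
      by (rule Ck_on_bump[OF open_UNIV Ck_on_add[OF open_UNIV Ck_on_const[OF open_UNIV] 2]])
    then show ?thesis using True by (simp add: \<psi>_def[abs_def])
  next
    case False
    then have "\<psi> i = (\<lambda>x. 0)" by (simp add: \<psi>_def[abs_def])
    then show ?thesis using Ck_on_const[OF open_UNIV, of k 0] by (simp del: Ck_on.simps)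
  qed
  have sum_smooth: "Ck_on k UNIV (\<lambda>x. \<Sum>i<N. \<psi> i x)" for k N
  proof (induction N)
    case 0
    then show ?case using Ck_on_const[OF open_UNIV, of k 0] by (simp del: Ck_on.simps)
  next
    case (Suc N)
    then show ?case using Ck_on_add[OF open_UNIV Suc psi_smooth] by (simp del: Ck_on.simps)
  qed
  show ?thesis
  proof (rule that[of \<eta>])
    fix N
    show "smooth_on UNIV (\<eta> N)"
      unfolding smooth_on_def \<eta>_def[abs_def]
      by (rule allI, rule Ck_on_bump[OF open_UNIV], rule Ck_on_linear[OF open_UNIV
            bounded_linear_mult_right sum_smooth])
    show "\<exists>C. compact C \<and> C \<subseteq> U \<and> (\<forall>x. x \<notin> C \<longrightarrow> \<eta> N x = 0)"
    proof (intro exI[of _ "\<Union>i<N. cball (c i) (r i)"] conjI allI impI)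
      show "compact (\<Union>i<N. cball (c i) (r i))" by (intro compact_UN) auto
      show "(\<Union>i<N. cball (c i) (r i)) \<subseteq> U" using cr(2) by blast
      fix x assume "x \<notin> (\<Union>i<N. cball (c i) (r i))"
      then have "(\<Sum>i<N. \<psi> i x) = 0" by (intro sum.neutral ballI psi_out) auto
      then show "\<eta> N x = 0" by (simp add: \<eta>_def bump_def)
    qed
    show "\<bar>\<eta> N x\<bar> \<le> 1" for x using bump_1_bounds by (simp add: \<eta>_def abs_le_iff)
  next
    fix x assume "x \<in> U"
    then obtain i where i: "x \<in> ball (c i) (r i)" using cover by blast
    have ge: "\<psi> i x \<le> (\<Sum>j<N. \<psi> j x)" if "N > i" for N
      using that psi0 by (intro member_le_sum) auto
    have "filterlim (\<lambda>N. \<psi> i x * real N) at_top sequentially"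
      by (rule filterlim_tendsto_pos_mult_at_top[OF tendsto_const psi_pos[OF i] filterlim_real_sequentially])
    then have top: "filterlim (\<lambda>N. real N * (\<Sum>j<N. \<psi> j x)) at_top sequentially"
    proof (rule filterlim_at_top_mono)
      show "\<forall>\<^sub>F N in sequentially. \<psi> i x * real N \<le> real N * (\<Sum>j<N. \<psi> j x)"
        using eventually_gt_at_top[of i]
        by eventually_elim (simp add: ge mult.commute mult_left_mono)
    qed
    have "((\<lambda>t. exp (- inverse t)) \<longlongrightarrow> exp (- (0::real))) at_top"
      by (rule tendsto_exp[OF tendsto_minus[OF tendsto_inverse_0_at_top[OF filterlim_ident]]])
    then have "((\<lambda>t. exp (- inverse t)) \<longlongrightarrow> (1::real)) at_top" by simp
    moreover have "\<forall>\<^sub>F t in at_top. exp (- inverse t) = bump 1 t"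
      using eventually_gt_at_top[of "0::real"]
      by eventually_elim (simp add: bump_def inverse_eq_divide)
    ultimately have "((\<lambda>t. bump 1 t) \<longlongrightarrow> 1) at_top"
      by (rule Lim_transform_eventually)
    then show "(\<lambda>N. \<eta> N x) \<longlonglongrightarrow> 1"
      unfolding \<eta>_def by (rule filterlim_compose[OF _ top])
  qed
qed

section \<open>Piecewise continuous fields on a mesh\<close>

lemma fe_mesh_cellD:
  assumes "fe_mesh M" "K \<in> cells M"
  shows "open K" "bounded K" "K \<subseteq> domain M"
proof -
  have "\<forall>K\<in>cells M. open K \<and> connected K \<and> K \<noteq> {} \<and> bounded K \<and> negligible (frontier K)
      \<and> K \<subseteq> domain M"
    using assms(1) unfolding fe_mesh_def by (elim conjE)
  then show "open K" "bounded K" "K \<subseteq> domain M" using assms(2) by auto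
qed

lemma finite_cells: "fe_mesh M \<Longrightarrow> finite (cells M)"
  unfolding fe_mesh_def by (elim conjE)

lemma
  assumes "fe_mesh M"
  shows open_Om: "open (Om M)" and bounded_Om: "bounded (Om M)"
    and Om_subset_domain: "Om M \<subseteq> domain M" and Om_borel: "Om M \<in> sets lborel"
    and emeasure_Om_finite: "emeasure lborel (Om M) < \<infinity>"
proof -
  note fin = finite_cells[OF assms]
  show op: "open (Om M)" unfolding Om_def using fe_mesh_cellD[OF assms] by (intro open_Union) auto
  show "bounded (Om M)" unfolding Om_def using fe_mesh_cellD[OF assms] fin
    by (intro bounded_Union) auto
  then show "emeasure lborel (Om M) < \<infinity>" by (rule emeasure_bounded_finite)
  show "Om M \<subseteq> domain M" unfolding Om_def using fe_mesh_cellD[OF assms] by blast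
  show "Om M \<in> sets lborel" using op by simp
qed

text \<open>The regularity that the discrete fields share with the products and quotients of them in the energy
  balance. It makes all of these bounded on \<open>\<Omega>\<close>, hence integrable.\<close>

definition pw_continuous :: "mesh \<Rightarrow> (R3 \<Rightarrow> 'a::euclidean_space) \<Rightarrow> bool" where
  "pw_continuous M u \<longleftrightarrow>
     (\<forall>K\<in>cells M. \<exists>g. continuous_on (closure K) g \<and> (\<forall>x\<in>K. u x = g x))"

lemma pw_continuousI: "continuous_on UNIV u \<Longrightarrow> pw_continuous M u"
  unfolding pw_continuous_def by (blast intro: continuous_on_subset)

lemma pw_continuous_cong:
  "pw_continuous M u \<Longrightarrow> (\<And>x. x \<in> Om M \<Longrightarrow> v x = u x) \<Longrightarrow> pw_continuous M v"
  unfolding pw_continuous_def Om_def by (metis UnionI)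

lemma pw_continuous_bilinear:
  assumes "bounded_bilinear m" "pw_continuous M u" "pw_continuous M v"
  shows "pw_continuous M (\<lambda>x. m (u x) (v x))"
  unfolding pw_continuous_def
proof
  fix K assume "K \<in> cells M"
  with assms(2,3) obtain f g where "continuous_on (closure K) f" "\<And>x. x \<in> K \<Longrightarrow> u x = f x"
    "continuous_on (closure K) g" "\<And>x. x \<in> K \<Longrightarrow> v x = g x"
    unfolding pw_continuous_def by metis
  then show "\<exists>h. continuous_on (closure K) h \<and> (\<forall>x\<in>K. m (u x) (v x) = h x)"
    by (intro exI[of _ "\<lambda>x. m (f x) (g x)"]) (auto intro: bounded_bilinear.continuous_on[OF assms(1)])
qed

lemma pw_continuous_add:
  assumes "pw_continuous M u" "pw_continuous M v"
  shows "pw_continuous M (\<lambda>x. u x + v x)"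
  unfolding pw_continuous_def
proof
  fix K assume "K \<in> cells M"
  with assms obtain f g where "continuous_on (closure K) f" "\<And>x. x \<in> K \<Longrightarrow> u x = f x"
    "continuous_on (closure K) g" "\<And>x. x \<in> K \<Longrightarrow> v x = g x"
    unfolding pw_continuous_def by metis
  then show "\<exists>h. continuous_on (closure K) h \<and> (\<forall>x\<in>K. u x + v x = h x)"
    by (intro exI[of _ "\<lambda>x. f x + g x"]) (auto intro: continuous_on_add)
qed

lemma pw_continuous_const: "pw_continuous M (\<lambda>x. c)"
  by (simp add: pw_continuousI)

lemma pw_continuous_linear:
  assumes "bounded_linear L" "pw_continuous M u"
  shows "pw_continuous M (\<lambda>x. L (u x))"
  unfolding pw_continuous_def
proof
  fix K assume "K \<in> cells M"
  with assms obtain f where "continuous_on (closure K) f" "\<And>x. x \<in> K \<Longrightarrow> u x = f x"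
    unfolding pw_continuous_def by metis
  then show "\<exists>h. continuous_on (closure K) h \<and> (\<forall>x\<in>K. L (u x) = h x)"
    by (intro exI[of _ "\<lambda>x. L (f x)"]) (auto intro: bounded_linear.continuous_on[OF assms(1)])
qed

lemma pw_continuous_sum:
  "finite A \<Longrightarrow> (\<And>i. i \<in> A \<Longrightarrow> pw_continuous M (u i)) \<Longrightarrow> pw_continuous M (\<lambda>x. \<Sum>i\<in>A. u i x)"
  by (induction A rule: finite_induct) (auto intro: pw_continuous_const pw_continuous_add)

lemmas pw_continuous_scaleR = pw_continuous_bilinear[OF bounded_bilinear_scaleR]
lemmas pw_continuous_mult = pw_continuous_bilinear[OF bounded_bilinear_mult]
lemmas pw_continuous_inner = pw_continuous_bilinear[OF bounded_bilinear_inner]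
lemmas pw_continuous_cross =
  pw_continuous_bilinear[OF bilinear_cross[unfolded bilinear_conv_bounded_bilinear]]

lemma at_within_cell:
  fixes K :: "R3 set"
  assumes "open K" "x \<in> closure K"
  shows "at x within K \<noteq> bot"
proof -
  have "x islimpt K"
  proof (cases "x \<in> K")
    case True
    then show ?thesis using assms(1) interior_limit_point interior_open by metis
  next
    case False
    then show ?thesis using assms(2) by (simp add: closure_def)
  qed
  then show ?thesis by (simp add: trivial_limit_within)
qed

lemma cell_trace_eq:
  assumes "open K" "x \<in> closure K" "continuous_on (closure K) g" "\<And>y. y \<in> K \<Longrightarrow> u y = g y"
  shows "cell_trace K u x = g x"
proof -
  have "(g \<longlongrightarrow> g x) (at x within closure K)"
    using assms(2,3) by (simp add: continuous_on_def)
  then have "(g \<longlongrightarrow> g x) (at x within K)"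
    by (rule tendsto_within_subset[OF _ closure_subset])
  moreover have "\<forall>\<^sub>F y in at x within K. g y = u y"
    using assms(4) by (auto simp: eventually_at_filter)
  ultimately have "(u \<longlongrightarrow> g x) (at x within K)" by (rule Lim_transform_eventually)
  then show ?thesis
    unfolding cell_trace_def by (rule tendsto_Lim[OF at_within_cell[OF assms(1,2)]])
qed

text \<open>The one-sided limits of \<open>n\<close> are the values of its continuous extension to the closed cell. This is where
  positivity up to the boundary matters: it makes \<open>1/n\<close> bounded.\<close>

lemma pw_continuous_inverse:
  fixes n :: sfield
  assumes "fe_mesh M" "pw_continuous M n"
    and pos: "\<forall>K\<in>cells M. \<forall>x\<in>closure K. 0 < cell_trace K n x"
  shows "pw_continuous M (\<lambda>x. inverse (n x))"
  unfolding pw_continuous_def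
proof
  fix K assume K: "K \<in> cells M"
  with assms(2) obtain g where g: "continuous_on (closure K) g" "\<And>x. x \<in> K \<Longrightarrow> n x = g x"
    unfolding pw_continuous_def by metis
  have "g x \<noteq> 0" if "x \<in> closure K" for x
    using pos[rule_format, OF K that] cell_trace_eq[OF fe_mesh_cellD(1)[OF assms(1) K] that g] by simp
  then show "\<exists>h. continuous_on (closure K) h \<and> (\<forall>x\<in>K. inverse (n x) = h x)"
    using g by (intro exI[of _ "\<lambda>x. inverse (g x)"]) (auto intro: continuous_on_inverse)
qed

lemma pw_continuous_bounded:
  assumes "fe_mesh M" "pw_continuous M u"
  obtains C where "\<And>x. x \<in> Om M \<Longrightarrow> norm (u x) \<le> C"
proof -
  note fin = finite_cells[OF assms(1)]
  have "\<exists>C. \<forall>x\<in>K. norm (u x) \<le> C" if K: "K \<in> cells M" for K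
  proof -
    obtain g where g: "continuous_on (closure K) g" "\<forall>x\<in>K. u x = g x"
      using assms(2) K unfolding pw_continuous_def by blast
    have "compact (closure K)"
      using fe_mesh_cellD(2)[OF assms(1) K] by (simp add: compact_closure)
    then have "bounded (g ` closure K)"
      by (rule compact_imp_bounded[OF compact_continuous_image[OF g(1)]])
    then obtain C where C: "\<forall>y\<in>g ` closure K. norm y \<le> C"
      unfolding bounded_iff by (elim exE)
    have "norm (u x) \<le> C" if "x \<in> K" for x
      using C g(2) subsetD[OF closure_subset that] that by simp
    then show ?thesis by blast
  qed
  then have "\<exists>C. \<forall>K\<in>cells M. \<forall>x\<in>K. norm (u x) \<le> C K" by (intro bchoice ballI)
  then obtain C where C: "\<And>K x. K \<in> cells M \<Longrightarrow> x \<in> K \<Longrightarrow> norm (u x) \<le> C K" by blast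
  show ?thesis
  proof (rule that[of "\<Sum>K\<in>cells M. \<bar>C K\<bar>"])
    fix x assume "x \<in> Om M"
    then obtain K where K: "K \<in> cells M" "x \<in> K" unfolding Om_def by blast
    have "norm (u x) \<le> \<bar>C K\<bar>" using C[OF K] by simp
    also have "\<dots> \<le> (\<Sum>K\<in>cells M. \<bar>C K\<bar>)" using K fin by (intro member_le_sum) auto
    finally show "norm (u x) \<le> (\<Sum>K\<in>cells M. \<bar>C K\<bar>)" .
  qed
qed

lemma pw_continuous_measurable:
  assumes "fe_mesh M" "pw_continuous M u"
  shows "set_borel_measurable lborel (Om M) u"
proof -
  have "continuous_on K u" if K: "K \<in> cells M" for K
  proof -
    obtain g where g: "continuous_on (closure K) g" "\<forall>x\<in>K. u x = g x"
      using assms(2) K unfolding pw_continuous_def by blast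
    show ?thesis
      using continuous_on_cong[of K K u g] continuous_on_subset[OF g(1) closure_subset] g(2) by blast
  qed
  then have "continuous_on (Om M) u"
    unfolding Om_def using fe_mesh_cellD(1)[OF assms(1)]
    by (intro continuous_on_open_Union) blast+
  then have "(\<lambda>x. indicator (Om M) x *\<^sub>R u x) \<in> borel_measurable borel"
    by (rule borel_measurable_continuous_on_indicator[rotated]) (rule borel_open[OF open_Om[OF assms(1)]])
  then show ?thesis unfolding set_borel_measurable_def by simp
qed

lemma pw_continuous_integrable:
  assumes "fe_mesh M" "pw_continuous M u"
  shows "set_integrable lborel (Om M) u"
proof -
  obtain C where C: "\<And>x. x \<in> Om M \<Longrightarrow> norm (u x) \<le> C"
    using pw_continuous_bounded[OF assms] by blast
  show ?thesis
    unfolding set_integrable_def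
  proof (rule integrableI_bounded_set[where A="Om M" and B=C])
    show "(\<lambda>x. indicator (Om M) x *\<^sub>R u x) \<in> borel_measurable lborel"
      using pw_continuous_measurable[OF assms] by (simp add: set_borel_measurable_def)
    show "AE x in lborel. x \<in> Om M \<longrightarrow> norm (indicator (Om M) x *\<^sub>R u x) \<le> C"
      using C by (intro AE_I2) simp
    show "AE x in lborel. x \<notin> Om M \<longrightarrow> indicator (Om M) x *\<^sub>R u x = 0"
      by (intro AE_I2) simp
  qed (fact Om_borel[OF assms(1)] emeasure_Om_finite[OF assms(1)])+
qed

lemma pw_continuous_L2: "fe_mesh M \<Longrightarrow> pw_continuous M u \<Longrightarrow> u \<in> L2 M"
  unfolding L2_def power2_norm_eq_inner
  by (simp add: pw_continuous_measurable pw_continuous_integrable pw_continuous_inner)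

text \<open>The weak derivatives are only known to be square integrable, so pairings with them are integrable by the
  Cauchy-Schwarz inequality.\<close>

lemma L2_inner_integrable:
  assumes "f \<in> L2 M" "g \<in> L2 M"
  shows "set_integrable lborel (Om M) (\<lambda>x. f x \<bullet> g x)"
proof (rule set_integrable_bound)
  show "set_integrable lborel (Om M) (\<lambda>x. (norm (f x))\<^sup>2 + (norm (g x))\<^sup>2)"
    using assms by (intro set_integral_add(1)) (auto simp: L2_def)
  have "(\<lambda>x. (indicator (Om M) x *\<^sub>R f x) \<bullet> (indicator (Om M) x *\<^sub>R g x)) \<in> borel_measurable lborel"
    using assms by (intro borel_measurable_inner) (auto simp: L2_def set_borel_measurable_def)
  moreover have "(\<lambda>x. (indicator (Om M) x *\<^sub>R f x) \<bullet> (indicator (Om M) x *\<^sub>R g x))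
      = (\<lambda>x. indicator (Om M) x *\<^sub>R (f x \<bullet> g x))"
    by (auto simp: indicator_def)
  ultimately show "set_borel_measurable lborel (Om M) (\<lambda>x. f x \<bullet> g x)"
    by (simp add: set_borel_measurable_def)
  have "norm (f x \<bullet> g x) \<le> norm ((norm (f x))\<^sup>2 + (norm (g x))\<^sup>2)" for x
  proof -
    have "\<bar>f x \<bullet> g x\<bar> \<le> norm (f x) * norm (g x)" by (rule Cauchy_Schwarz_ineq2)
    also have "\<dots> \<le> (norm (f x))\<^sup>2 + (norm (g x))\<^sup>2"
      using sum_squares_bound[of "norm (f x)" "norm (g x)"]
        mult_nonneg_nonneg[OF norm_ge_zero[of "f x"] norm_ge_zero[of "g x"]] by linarith
    finally show ?thesis by simp
  qed
  then show "AE x in lborel. x \<in> Om M \<longrightarrow> norm (f x \<bullet> g x) \<le> norm ((norm (f x))\<^sup>2 + (norm (g x))\<^sup>2)"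
    by simp
qed

lemma ip_cong:
  assumes "fe_mesh M" "\<And>x. x \<in> Om M \<Longrightarrow> f x \<bullet> g x = f' x \<bullet> g' x"
  shows "ip M f g = ip M f' g'"
  unfolding ip_def by (rule set_lebesgue_integral_cong[OF Om_borel[OF assms(1)]]) (use assms(2) in auto)

lemma ip_commute: "ip M f g = ip M g f"
  by (simp add: ip_def inner_commute)

lemma ip_linear_left:
  assumes "f \<in> L2 M" "f' \<in> L2 M" "g \<in> L2 M"
  shows "ip M (\<lambda>x. a *\<^sub>R f x + b *\<^sub>R f' x) g = a * ip M f g + b * ip M f' g"
proof -
  note int = L2_inner_integrable[OF assms(1,3)] L2_inner_integrable[OF assms(2,3)]
  show ?thesis
    unfolding ip_def inner_add_left inner_scaleR_left
    using int by (subst set_integral_add(2)) auto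
qed

lemma ip_zero: "ip M (\<lambda>x. 0) g = 0" "ip M f (\<lambda>x. 0) = 0"
  by (simp_all add: ip_def)

lemma L2_linear:
  fixes f :: "R3 \<Rightarrow> 'a::euclidean_space"
  assumes "f \<in> L2 M" "f' \<in> L2 M"
  shows "(\<lambda>x. a *\<^sub>R f x + b *\<^sub>R f' x) \<in> L2 M"
proof -
  have "(\<lambda>x. a *\<^sub>R (indicator (Om M) x *\<^sub>R f x) + b *\<^sub>R (indicator (Om M) x *\<^sub>R f' x))
      \<in> borel_measurable lborel"
    using assms unfolding L2_def set_borel_measurable_def
    by (intro borel_measurable_add borel_measurable_scaleR[OF borel_measurable_const]) auto
  then have "set_borel_measurable lborel (Om M) (\<lambda>x. a *\<^sub>R f x + b *\<^sub>R f' x)"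
    unfolding set_borel_measurable_def by (simp add: scaleR_right_distrib mult.commute)
  moreover have "set_integrable lborel (Om M) (\<lambda>x. (norm (a *\<^sub>R f x + b *\<^sub>R f' x))\<^sup>2)"
  proof -
    have "set_integrable lborel (Om M)
      (\<lambda>x. a\<^sup>2 *\<^sub>R (f x \<bullet> f x) + ((2 * a * b) *\<^sub>R (f x \<bullet> f' x) + b\<^sup>2 *\<^sub>R (f' x \<bullet> f' x)))"
      by (intro set_integral_add(1) set_integrable_scaleR_right L2_inner_integrable assms)
    then show ?thesis
      unfolding power2_norm_eq_inner
      by (simp add: inner_add_left inner_add_right inner_commute power2_eq_square algebra_simps)
  qed
  ultimately show ?thesis unfolding L2_def by simp
qed

section \<open>Integration by parts\<close>

lemma pd_eq: "(f has_derivative D) (at x) \<Longrightarrow> pd i f x = D (axis i 1)"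
  unfolding pd_def using frechet_derivative_at by metis

lemma pd_cong:
  assumes "open U" "x \<in> U" "\<And>y. y \<in> U \<Longrightarrow> f y = g y" "f differentiable (at x)"
  shows "pd i f x = pd i g x"
  unfolding pd_def by (simp add: frechet_derivative_transform_within_open[OF assms(4,1,2,3)])

lemma integral_translate:
  fixes u :: "R3 \<Rightarrow> real"
  assumes "u \<in> borel_measurable borel"
  shows "(\<integral>x. u (x + c) \<partial>lborel) = (\<integral>x. u x \<partial>lborel)"
proof -
  have "(\<integral>x. u x \<partial>lborel) = (\<integral>x. u x \<partial>(distr lborel borel ((+) c)))"
    by (simp add: lborel_distr_plus)
  also have "\<dots> = (\<integral>x. u (c + x) \<partial>lborel)"
    using assms by (intro integral_distr) auto
  finally show ?thesis by (simp add: add.commute)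
qed

text \<open>The integral of \<open>x \<mapsto> (u(x + h e) - u(x))/h\<close> vanishes for every \<open>h\<close> by translation invariance. The limit
  \<open>h \<rightarrow> 0\<close> is taken by dominated convergence.\<close>

lemma integral_pd_zero:
  fixes u :: "R3 \<Rightarrow> real"
  assumes diff: "\<And>x. u differentiable (at x)" and cont: "continuous_on UNIV (pd i u)"
    and C: "compact C" and zero: "\<And>x. x \<notin> C \<Longrightarrow> u x = 0"
  shows "integrable lborel (pd i u)" "(\<integral>x. pd i u x \<partial>lborel) = 0"
    "\<And>x. x \<notin> C \<Longrightarrow> pd i u x = 0"
proof -
  define e :: R3 where "e = axis i 1"
  define h where "h N = inverse (real (Suc N))" for N
  have h: "0 < h N" "h N \<le> 1" for N by (auto simp: h_def divide_simps)
  have ne: "norm e = 1" by (simp add: e_def norm_axis_1)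
  have pd0: "pd i u x = 0" if "x \<notin> C" for x
  proof -
    have "pd i (\<lambda>y. 0) x = pd i u x"
      by (rule pd_cong[OF open_Compl[OF compact_imp_closed[OF C]]]) (use that zero in simp_all)
    then show ?thesis by (simp add: pd_def)
  qed
  then show "\<And>x. x \<notin> C \<Longrightarrow> pd i u x = 0" .
  have "bounded (pd i u ` C)"
    by (rule compact_imp_bounded[OF compact_continuous_image[OF continuous_on_subset[OF cont] C]]) simp
  then obtain B where "\<forall>y\<in>pd i u ` C. norm y \<le> B" using bounded_iff by metis
  then have B': "\<bar>pd i u x\<bar> \<le> max B 0" for x using pd0[of x] by (cases "x \<in> C") auto
  define B' where "B' = max B 0"
  have B: "\<bar>pd i u x\<bar> \<le> B'" for x using B' unfolding B'_def .
  \<comment> \<open>The difference quotients with \<open>h \<le> 1\<close> are supported in the ball of radius \<open>R + 1\<close> and bounded by \<open>B'\<close>.\<close>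
  obtain R where R: "C \<subseteq> cball 0 R" 
    using compact_imp_bounded[OF C] bounded_any_center[of C 0] by (auto simp: subset_eq)
  have line: "((\<lambda>s. u (x + s *\<^sub>R e)) has_real_derivative pd i u (x + s *\<^sub>R e)) (at s)" for x s
  proof -
    have a: "((\<lambda>s. x + s *\<^sub>R e) has_derivative (\<lambda>v. v *\<^sub>R e)) (at s)"
      by (auto intro!: derivative_eq_intros)
    have b: "(u has_derivative frechet_derivative u (at (x + s *\<^sub>R e))) (at (x + s *\<^sub>R e))"
      using diff by (simp add: frechet_derivative_works)
    have "frechet_derivative u (at (x + s *\<^sub>R e)) (v *\<^sub>R e) = pd i u (x + s *\<^sub>R e) * v" for v
      using linear_cmul[OF has_derivative_linear[OF b]] by (simp add: pd_def e_def)
    then show ?thesis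
      unfolding has_field_derivative_def using has_derivative_compose[OF a b] by simp
  qed
  have contu: "continuous_on UNIV u"
    using differentiable_imp_continuous_within[OF diff] by (intro continuous_at_imp_continuous_on) simp
  then have mu: "u \<in> borel_measurable borel" by (rule borel_measurable_continuous_onI)
  have cbf: "emeasure lborel (cball (0::R3) r) < \<infinity>" for r
    by (rule emeasure_bounded_finite) auto
  have lip: "\<bar>u (x + s *\<^sub>R e) - u x\<bar> \<le> B' * s" if "s > 0" for x s
  proof -
    obtain z where "u (x + s *\<^sub>R e) - u (x + 0 *\<^sub>R e) = (s - 0) * pd i u (x + z *\<^sub>R e)"
      using MVT2[OF \<open>s > 0\<close>, of "\<lambda>s. u (x + s *\<^sub>R e)" "\<lambda>s. pd i u (x + s *\<^sub>R e)"] line by metis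
    then show ?thesis using B[of "x + z *\<^sub>R e"] that
      by (simp add: abs_mult mult.commute mult_left_mono)
  qed
  have intu: "integrable lborel u"
  proof -
    have "bounded (u ` C)"
      by (rule compact_imp_bounded[OF compact_continuous_image[OF continuous_on_subset[OF contu] C]]) simp
    then obtain D where D: "\<forall>y\<in>u ` C. norm y \<le> D" using bounded_iff by metis
    have bound: "norm (u x) \<le> max D 0" for x using D zero[of x] by (cases "x \<in> C") auto
    show ?thesis
    proof (rule integrableI_bounded_set[where A="cball 0 R" and B="max D 0"])
      show "AE x in lborel. x \<notin> cball 0 R \<longrightarrow> u x = 0" using R zero by (intro AE_I2) blast
    qed (use bound cbf mu in auto)
  qed
  have intus: "integrable lborel (\<lambda>x. u (x + c))" for c
    using integrable_distr[of "(+) c" lborel borel u] intu by (simp add: lborel_distr_plus add.commute)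
  define q where "q N x = (u (x + h N *\<^sub>R e) - u x) / h N" for N x
  define w where "w x = B' * indicator (cball 0 (R + 1)) x" for x :: R3
  have wint: "integrable lborel w"
    unfolding w_def[abs_def] using cbf
    by (intro integrable_mult_right integrable_real_indicator) auto
  have qw: "norm (q N x) \<le> w x" for N x
  proof (cases "x \<in> cball 0 (R + 1)")
    case True
    have "\<bar>u (x + h N *\<^sub>R e) - u x\<bar> \<le> B' * h N" using lip h by blast
    then show ?thesis using True h[of N] by (simp add: q_def w_def field_simps)
  next
    case False
    have "norm x \<le> norm (x + h N *\<^sub>R e) + norm (h N *\<^sub>R e)"
      using norm_triangle_ineq4[of "x + h N *\<^sub>R e" "h N *\<^sub>R e"] by simp
    then have "norm x \<le> norm (x + h N *\<^sub>R e) + 1" using h[of N] ne by simp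
    then have "x \<notin> C" "x + h N *\<^sub>R e \<notin> C" using False R by auto
    then show ?thesis using False zero by (simp add: q_def w_def)
  qed
  have qlim: "(\<lambda>N. q N x) \<longlonglongrightarrow> pd i u x" for x
  proof -
    have "((\<lambda>s. (u (x + s *\<^sub>R e) - u x) / s) \<longlongrightarrow> pd i u x) (at 0)"
      using line[of x 0] by (simp add: DERIV_def)
    moreover have "filterlim h (at 0) sequentially"
      unfolding filterlim_at
    proof
      show "\<forall>\<^sub>F N in sequentially. h N \<in> UNIV \<and> h N \<noteq> 0"
        using h(1) by (intro always_eventually) (metis UNIV_I less_irrefl)
      show "h \<longlonglongrightarrow> 0" unfolding h_def[abs_def] by (rule LIMSEQ_inverse_real_of_nat)
    qed
    ultimately show ?thesis unfolding q_def by (rule filterlim_compose)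
  qed
  have qm: "q N \<in> borel_measurable lborel" for N
    unfolding q_def[abs_def]
    by (intro borel_measurable_divide borel_measurable_diff borel_measurable_const
        borel_measurable_integrable[OF intus] borel_measurable_integrable[OF intu])
  have pm: "pd i u \<in> borel_measurable lborel"
    using borel_measurable_continuous_onI[OF cont] by simp
  show "integrable lborel (pd i u)"
    by (rule integrable_dominated_convergence[of _ _ q w])
       (use pm qm wint qlim qw in auto)
  have "(\<lambda>N. \<integral>x. q N x \<partial>lborel) \<longlonglongrightarrow> (\<integral>x. pd i u x \<partial>lborel)"
    by (rule integral_dominated_convergence[of _ _ q w])
       (use pm qm wint qlim qw in auto)
  moreover have "(\<integral>x. q N x \<partial>lborel) = 0" for N
    unfolding q_def
    by (simp add: Bochner_Integration.integral_diff[OF intus intu] integral_translate[OF mu])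
  ultimately show "(\<integral>x. pd i u x \<partial>lborel) = 0" by (simp add: LIMSEQ_const_iff)
qed

lemma fe_mesh_periodsD:
  assumes "fe_mesh M"
  shows "0 \<in> periods M" "\<And>p q. p \<in> periods M \<Longrightarrow> q \<in> periods M \<Longrightarrow> p - q \<in> periods M"
    "\<And>p. p \<in> periods M \<Longrightarrow> translate p (domain M) = domain M"
    "\<And>K L p. K \<in> cells M \<Longrightarrow> L \<in> cells M \<Longrightarrow> p \<in> periods M \<Longrightarrow> p \<noteq> 0 \<Longrightarrow> K \<inter> translate p L = {}"
proof -
  have "\<forall>p\<in>periods M. \<forall>q\<in>periods M. p - q \<in> periods M"
    using assms unfolding fe_mesh_def by (elim conjE)
  moreover have "\<forall>p\<in>periods M. translate p (domain M) = domain M"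
    using assms unfolding fe_mesh_def by (elim conjE)
  moreover have "\<forall>K\<in>cells M. \<forall>L\<in>cells M. \<forall>p\<in>periods M. K \<noteq> L \<or> p \<noteq> 0 \<longrightarrow> K \<inter> translate p L = {}"
    using assms unfolding fe_mesh_def by (elim conjE)
  ultimately show "\<And>p q. p \<in> periods M \<Longrightarrow> q \<in> periods M \<Longrightarrow> p - q \<in> periods M"
    "\<And>p. p \<in> periods M \<Longrightarrow> translate p (domain M) = domain M"
    "\<And>K L p. K \<in> cells M \<Longrightarrow> L \<in> cells M \<Longrightarrow> p \<in> periods M \<Longrightarrow> p \<noteq> 0 \<Longrightarrow> K \<inter> translate p L = {}"
    by (blast+)
  show "0 \<in> periods M" using assms unfolding fe_mesh_def by (elim conjE)
qed

lemma periods_minus: "fe_mesh M \<Longrightarrow> p \<in> periods M \<Longrightarrow> - p \<in> periods M"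
  using fe_mesh_periodsD(2)[of M 0 p] fe_mesh_periodsD(1)[of M] by simp

lemma periods_add: "fe_mesh M \<Longrightarrow> p \<in> periods M \<Longrightarrow> q \<in> periods M \<Longrightarrow> p + q \<in> periods M"
  using fe_mesh_periodsD(2)[of M p "- q"] periods_minus[of M q] by simp

lemma Om_translate_unique:
  assumes M: "fe_mesh M" and "x \<in> Om M" "x + p \<in> Om M" "p \<in> periods M"
  shows "p = 0"
proof (rule ccontr)
  assume "p \<noteq> 0"
  obtain K L where KL: "K \<in> cells M" "x \<in> K" "L \<in> cells M" "x + p \<in> L"
    using assms(2,3) unfolding Om_def by blast
  have "x \<in> translate (- p) L" using KL(4) by (intro image_eqI[of _ _ "x + p"]) auto
  then show False
    using fe_mesh_periodsD(4)[OF M KL(1,3) periods_minus[OF M assms(4)]] KL(2) \<open>p \<noteq> 0\<close> by auto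
qed

text \<open>Test functions are periodic, so a function supported in the cells is copied to all their translates. Each
  point has at most one translate in \<open>Om M\<close>, which makes the copy well defined. The compact support
  keeps a distance \<open>\<epsilon>\<close> from the complement of \<open>Om M\<close>, so a point without a translate in
  \<open>Om M\<close> has a neighbourhood on which the copy is zero.\<close>

lemma test_fun_extension:
  fixes \<phi> :: "R3 \<Rightarrow> 'a::euclidean_space"
  assumes M: "fe_mesh M" and smooth: "smooth_on UNIV \<phi>"
    and C: "compact C" "C \<subseteq> Om M" "\<And>x. x \<notin> C \<Longrightarrow> \<phi> x = 0"
  obtains \<psi> where "test_fun M \<psi>" "\<And>x. x \<in> Om M \<Longrightarrow> \<psi> x = \<phi> x"
proof -
  define good where "good x p \<longleftrightarrow> p \<in> periods M \<and> x + p \<in> Om M" for x p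
  define \<psi> where "\<psi> x = (if \<exists>p. good x p then \<phi> (x + (SOME p. good x p)) else 0)" for x
  have psi_eq: "\<psi> x = \<phi> (x + p)" if "good x p" for x p
  proof -
    define q where "q = (SOME q. good x q)"
    have q: "good x q" unfolding q_def using that by (rule someI)
    have "q - p = 0"
      by (rule Om_translate_unique[OF M, of "x + p"])
         (use q that fe_mesh_periodsD(2)[OF M] in \<open>auto simp: good_def\<close>)
    moreover have "\<psi> x = \<phi> (x + q)" unfolding \<psi>_def q_def using that by (simp add: exI)
    ultimately show ?thesis by simp
  qed
  have psi_0: "\<psi> x = 0" if "\<not> (\<exists>p. good x p)" for x
    unfolding \<psi>_def by (rule if_not_P[OF that])
  obtain \<epsilon> where eps: "\<epsilon> > 0" "(\<Union>x\<in>C. ball x \<epsilon>) \<subseteq> Om M"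
    using compact_subset_open_imp_ball_epsilon_subset[OF C(1) open_Om[OF M] C(2)] by metis
  have near: "\<exists>p. good x p" if y: "\<psi> y \<noteq> 0" "dist y x < \<epsilon>" for x y
  proof -
    obtain p where p: "good y p" using y(1) psi_0 by metis
    then have "y + p \<in> C" using y(1) psi_eq[OF p] C(3) by metis
    moreover have "x + p \<in> ball (y + p) \<epsilon>" using y(2) by (simp add: dist_norm)
    ultimately have "x + p \<in> Om M" using eps(2) by blast
    then show ?thesis using p unfolding good_def by blast
  qed
  have "smooth_on UNIV \<psi>"
    unfolding smooth_on_def
  proof (intro allI Ck_on_local)
    fix k x
    show "\<exists>W. open W \<and> x \<in> W \<and> Ck_on k W \<psi>"
    proof (cases "\<exists>p. good x p")
      case True
      then obtain p where p: "good x p" by blast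
      let ?W = "{y. y + p \<in> Om M}"
      have op: "open ?W"
        using open_vimage[OF open_Om[OF M], of "\<lambda>x. x + p"] by (simp add: vimage_def continuous_intros)
      have "Ck_on k (Om M) \<phi>"
        using smooth Ck_on_subset unfolding smooth_on_def by (metis subset_UNIV)
      then have "Ck_on k ?W (\<lambda>y. \<phi> (y + p))" by (rule Ck_on_translate[OF _ open_Om[OF M]])
      moreover have "\<phi> (y + p) = \<psi> y" if "y \<in> ?W" for y
        using psi_eq[of y p] p that by (simp add: good_def)
      ultimately have "Ck_on k ?W \<psi>" using Ck_on_cong[OF op] by metis
      then show ?thesis using op p unfolding good_def by blast
    next
      case False
      have "0 = \<psi> y" if "y \<in> ball x \<epsilon>" for y
        using near[of y x] False that by (auto simp: dist_commute)
      then have "Ck_on k (ball x \<epsilon>) \<psi>"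
        by (rule Ck_on_cong[OF open_ball _ Ck_on_const[OF open_ball]])
      then show ?thesis using eps(1) by (intro exI[of _ "ball x \<epsilon>"]) simp
    qed
  qed
  moreover have "\<psi> (x + q) = \<psi> x" if q: "q \<in> periods M" for x q
  proof (cases "\<exists>p. good x p")
    case True
    then obtain p where p: "good x p" by blast
    then have "good (x + q) (p - q)" using q fe_mesh_periodsD(2)[OF M] by (simp add: good_def)
    then show ?thesis using psi_eq[OF p] psi_eq[of "x + q" "p - q"] by simp
  next
    case False
    have "\<not> good (x + q) p" for p
    proof
      assume "good (x + q) p"
      then have "good x (q + p)" using periods_add[OF M q] by (simp add: good_def add.assoc)
      then show False using False by blast
    qed
    then show ?thesis using False psi_0 by metis
  qed
  moreover have "closure {x. \<psi> x \<noteq> 0} \<subseteq> domain M"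
  proof
    fix x assume "x \<in> closure {x. \<psi> x \<noteq> 0}"
    then obtain y where "\<psi> y \<noteq> 0" "dist y x < \<epsilon>" using eps(1) unfolding closure_approachable by blast
    then obtain p where p: "good x p" using near by blast
    then have "x + p \<in> domain M" using Om_subset_domain[OF M] unfolding good_def by blast
    then have "x \<in> translate (- p) (domain M)" by (intro image_eqI[of _ _ "x + p"]) auto
    then show "x \<in> domain M"
      using fe_mesh_periodsD(3)[OF M periods_minus[OF M]] p unfolding good_def by blast
  qed
  ultimately have "test_fun M \<psi>" unfolding test_fun_def by blast
  moreover have "\<psi> x = \<phi> x" if "x \<in> Om M" for x
    using psi_eq[of x 0] that fe_mesh_periodsD(1)[OF M] by (simp add: good_def)
  ultimately show ?thesis by (rule that)
qed

lemma Ck_on_cutoff_extend: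
  fixes w :: "R3 \<Rightarrow> 'a::real_normed_vector"
  assumes "open U" "Ck_on k U w" "Ck_on k UNIV \<eta>"
    and C: "compact C" "C \<subseteq> U" "\<And>x. x \<notin> C \<Longrightarrow> \<eta> x = 0"
  shows "Ck_on k UNIV (\<lambda>x. \<eta> x *\<^sub>R w x)"
proof (rule Ck_on_local)
  fix x
  have 1: "Ck_on k U (\<lambda>x. \<eta> x *\<^sub>R w x)"
    by (rule Ck_on_bilinear[OF assms(1) bounded_bilinear_scaleR Ck_on_subset[OF assms(3) subset_UNIV]
          assms(2)])
  have op: "open (- C)" using C(1) by (simp add: compact_imp_closed open_Compl)
  have 2: "Ck_on k (- C) (\<lambda>x. \<eta> x *\<^sub>R w x)"
    by (rule Ck_on_cong[OF op _ Ck_on_const[OF op, of k 0]]) (simp add: C(3))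
  show "\<exists>W. open W \<and> x \<in> W \<and> Ck_on k W (\<lambda>x. \<eta> x *\<^sub>R w x)"
  proof (cases "x \<in> C")
    case True
    then show ?thesis using 1 assms(1) C(2) by blast
  next
    case False
    then show ?thesis using 2 op by blast
  qed
qed

lemma C1_pd_continuous:
  assumes "Ck_on 1 U f"
  shows "continuous_on U (pd i f)"
  using assms unfolding pd_def[abs_def] by simp

lemma C1_differentiable:
  assumes "Ck_on 1 U f" "x \<in> U"
  shows "f differentiable (at x)"
  using assms by simp

lemma pw_continuous_divh:
  assumes "Ck_on 1 UNIV \<phi>"
  shows "pw_continuous M (divh M \<phi>)"
proof (rule pw_continuous_cong)
  show "pw_continuous M (\<lambda>x. \<Sum>i\<in>UNIV. pd i \<phi> x $ i)"
    by (intro pw_continuousI continuous_on_sum continuous_on_component C1_pd_continuous assms)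
qed (simp add: divh_def)

lemma pw_continuous_gradh:
  assumes "Ck_on 1 UNIV \<phi>"
  shows "pw_continuous M (gradh M \<phi>)"
proof (rule pw_continuous_cong)
  show "pw_continuous M (\<lambda>x. \<chi> i. pd i \<phi> x)"
    by (intro pw_continuousI continuous_on_vec_lambda C1_pd_continuous assms)
qed (simp add: gradh_def)

lemma divh_cong:
  assumes "fe_mesh M" "x \<in> Om M" "\<And>y. y \<in> Om M \<Longrightarrow> f y = g y" "f differentiable (at x)"
  shows "divh M f x = divh M g x"
  using pd_cong[OF open_Om[OF assms(1)] assms(2,3,4)] by (simp add: divh_def)

lemma gradh_cong:
  assumes "fe_mesh M" "x \<in> Om M" "\<And>y. y \<in> Om M \<Longrightarrow> f y = g y" "f differentiable (at x)"
  shows "gradh M f x = gradh M g x"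
  using pd_cong[OF open_Om[OF assms(1)] assms(2,3,4)] by (simp add: gradh_def)

text \<open>Both identities express that the divergence of \<open>\<eta> a w\<close>, a \<open>C\<^sup>1\<close> vector field with compact support in
  \<open>Om M\<close>, has integral zero; they only differ in the factor that carries the cutoff \<open>\<eta>\<close>.\<close>

lemma green_cutoff:
  fixes a \<eta> :: sfield and w :: vfield
  assumes M: "fe_mesh M"
    and a: "smooth_on (Om M) a" "pw_continuous M a" "pw_continuous M (gradh M a)"
    and w: "smooth_on (Om M) w" "pw_continuous M w" "pw_continuous M (divh M w)"
    and \<eta>: "smooth_on UNIV \<eta>" and C: "compact C" "C \<subseteq> Om M" "\<And>x. x \<notin> C \<Longrightarrow> \<eta> x = 0"
  shows "ip M a (divh M (\<lambda>x. \<eta> x *\<^sub>R w x)) = - ip M (gradh M a) (\<lambda>x. \<eta> x *\<^sub>R w x)"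
    and "ip M w (gradh M (\<lambda>x. \<eta> x *\<^sub>R a x)) = - ip M (divh M w) (\<lambda>x. \<eta> x *\<^sub>R a x)"
proof -
  note op = open_Om[OF M]
  define u where "u i x = \<eta> x *\<^sub>R (a x * w x $ i)" for i x
  have etaC: "Ck_on k UNIV \<eta>" for k using \<eta> unfolding smooth_on_def by blast
  have aC: "Ck_on k (Om M) a" and wC: "Ck_on k (Om M) w" for k
    using a(1) w(1) unfolding smooth_on_def by blast+
  have wiC: "Ck_on k (Om M) (\<lambda>x. w x $ i)" for k i
    by (rule Ck_on_linear[OF op bounded_linear_vec_nth wC])
  have uC: "Ck_on 1 UNIV (u i)" for i
    unfolding u_def[abs_def]
    by (rule Ck_on_cutoff_extend[OF op Ck_on_bilinear[OF op bounded_bilinear_mult aC wiC] etaC C])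
  have phiC: "Ck_on 1 UNIV (\<lambda>x. \<eta> x *\<^sub>R w x)"
    by (rule Ck_on_cutoff_extend[OF op wC etaC C])
  have eaC: "Ck_on 1 UNIV (\<lambda>x. \<eta> x *\<^sub>R a x)"
    by (rule Ck_on_cutoff_extend[OF op aC etaC C])
  have u0: "u i x = 0" if "x \<notin> C" for i x using C(3)[OF that] by (simp add: u_def)
  note zero = integral_pd_zero[OF C1_differentiable[OF uC UNIV_I] C1_pd_continuous[OF uC] C(1) u0]
  have "(\<integral>x. (\<Sum>i\<in>UNIV. pd i (u i) x) \<partial>lborel) = 0"
    using zero(1,2) by (simp add: Bochner_Integration.integral_sum)
  moreover have "indicator (Om M) x *\<^sub>R (\<Sum>i\<in>UNIV. pd i (u i) x) = (\<Sum>i\<in>UNIV. pd i (u i) x)" for x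
    using zero(3) C(2) by (cases "x \<in> Om M") (auto simp: subset_eq intro!: sum.neutral)
  ultimately have tot: "(LINT x:Om M|lborel. \<Sum>i\<in>UNIV. pd i (u i) x) = 0"
    unfolding set_lebesgue_integral_def by presburger
  have D: "pd i (u i) x = a x * pd i (\<lambda>x. \<eta> x *\<^sub>R w x) x $ i + pd i a x * (\<eta> x *\<^sub>R w x) $ i"
    "pd i (u i) x = w x $ i * pd i (\<lambda>x. \<eta> x *\<^sub>R a x) x + pd i w x $ i * (\<eta> x *\<^sub>R a x)"
    if x: "x \<in> Om M" for i x
  proof -
    let ?e = "axis i 1 :: R3"
    have He: "(\<eta> has_derivative frechet_derivative \<eta> (at x)) (at x)"
      by (rule Ck_on_differentiable[OF etaC UNIV_I])
    have Ha: "(a has_derivative frechet_derivative a (at x)) (at x)"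
      by (rule Ck_on_differentiable[OF aC x])
    have Hw: "(w has_derivative frechet_derivative w (at x)) (at x)"
      by (rule Ck_on_differentiable[OF wC x])
    note Hwi = bounded_linear.has_derivative[OF bounded_linear_vec_nth Hw]
    have 1: "pd i (u i) x = \<eta> x * (a x * pd i w x $ i + pd i a x * w x $ i) + pd i \<eta> x * (a x * w x $ i)"
      unfolding u_def[abs_def] pd_eq[OF has_derivative_scaleR[OF He has_derivative_mult[OF Ha Hwi]]]
      by (simp add: pd_def)
    have 2: "pd i (\<lambda>x. \<eta> x *\<^sub>R w x) x = \<eta> x *\<^sub>R pd i w x + pd i \<eta> x *\<^sub>R w x"
      unfolding pd_eq[OF has_derivative_scaleR[OF He Hw]] by (simp add: pd_def)
    have 3: "pd i (\<lambda>x. \<eta> x *\<^sub>R a x) x = \<eta> x *\<^sub>R pd i a x + pd i \<eta> x *\<^sub>R a x"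
      unfolding pd_eq[OF has_derivative_scaleR[OF He Ha]] by (simp add: pd_def)
    show "pd i (u i) x = a x * pd i (\<lambda>x. \<eta> x *\<^sub>R w x) x $ i + pd i a x * (\<eta> x *\<^sub>R w x) $ i"
      unfolding 1 2 by (simp add: algebra_simps)
    show "pd i (u i) x = w x $ i * pd i (\<lambda>x. \<eta> x *\<^sub>R a x) x + pd i w x $ i * (\<eta> x *\<^sub>R a x)"
      unfolding 1 3 by (simp add: algebra_simps)
  qed
  have pw_eta: "pw_continuous M \<eta>" using etaC[of 0] by (intro pw_continuousI) simp
  note int = pw_continuous_integrable[OF M pw_continuous_inner]
  have 1: "ip M a (divh M (\<lambda>x. \<eta> x *\<^sub>R w x)) + ip M (gradh M a) (\<lambda>x. \<eta> x *\<^sub>R w x)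
      = (LINT x:Om M|lborel. a x \<bullet> divh M (\<lambda>x. \<eta> x *\<^sub>R w x) x + gradh M a x \<bullet> (\<eta> x *\<^sub>R w x))"
    unfolding ip_def
    by (rule set_integral_add(2)[symmetric, OF int[OF a(2) pw_continuous_divh[OF phiC]]
          int[OF a(3) pw_continuous_scaleR[OF pw_eta w(2)]]])
  have 2: "\<dots> = (LINT x:Om M|lborel. \<Sum>i\<in>UNIV. pd i (u i) x)"
  proof (rule set_lebesgue_integral_cong[OF Om_borel[OF M]], intro allI impI)
    fix x assume x: "x \<in> Om M"
    show "a x \<bullet> divh M (\<lambda>x. \<eta> x *\<^sub>R w x) x + gradh M a x \<bullet> (\<eta> x *\<^sub>R w x) = (\<Sum>i\<in>UNIV. pd i (u i) x)"
      unfolding D(1)[OF x]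
      using x by (simp add: divh_def gradh_def inner_vec_def sum.distrib sum_distrib_left)
  qed
  show "ip M a (divh M (\<lambda>x. \<eta> x *\<^sub>R w x)) = - ip M (gradh M a) (\<lambda>x. \<eta> x *\<^sub>R w x)"
    using 1 2 tot by simp
  have 3: "ip M w (gradh M (\<lambda>x. \<eta> x *\<^sub>R a x)) + ip M (divh M w) (\<lambda>x. \<eta> x *\<^sub>R a x)
      = (LINT x:Om M|lborel. w x \<bullet> gradh M (\<lambda>x. \<eta> x *\<^sub>R a x) x + divh M w x \<bullet> (\<eta> x *\<^sub>R a x))"
    unfolding ip_def
    by (rule set_integral_add(2)[symmetric, OF int[OF w(2) pw_continuous_gradh[OF eaC]]
          int[OF w(3) pw_continuous_scaleR[OF pw_eta a(2)]]])
  have 4: "\<dots> = (LINT x:Om M|lborel. \<Sum>i\<in>UNIV. pd i (u i) x)"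
  proof (rule set_lebesgue_integral_cong[OF Om_borel[OF M]], intro allI impI)
    fix x assume x: "x \<in> Om M"
    show "w x \<bullet> gradh M (\<lambda>x. \<eta> x *\<^sub>R a x) x + divh M w x \<bullet> (\<eta> x *\<^sub>R a x) = (\<Sum>i\<in>UNIV. pd i (u i) x)"
      unfolding D(2)[OF x]
      using x by (simp add: divh_def gradh_def inner_vec_def sum.distrib sum_distrib_right)
  qed
  show "ip M w (gradh M (\<lambda>x. \<eta> x *\<^sub>R a x)) = - ip M (divh M w) (\<lambda>x. \<eta> x *\<^sub>R a x)"
    using 3 4 tot by simp
qed

lemma ip_cutoff_tendsto:
  fixes f w :: "R3 \<Rightarrow> 'a::euclidean_space"
  assumes M: "fe_mesh M" and f: "f \<in> L2 M" and w: "pw_continuous M w"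
    and smooth: "\<And>N. smooth_on UNIV (\<eta> N)" and bound: "\<And>N x. \<bar>\<eta> N x\<bar> \<le> (1::real)"
    and lim: "\<And>x. x \<in> Om M \<Longrightarrow> (\<lambda>N. \<eta> N x) \<longlonglongrightarrow> 1"
  shows "(\<lambda>N. ip M f (\<lambda>x. \<eta> N x *\<^sub>R w x)) \<longlonglongrightarrow> ip M f w"
proof -
  have int: "integrable lborel (\<lambda>x. indicator (Om M) x *\<^sub>R (f x \<bullet> w x))"
    using L2_inner_integrable[OF f pw_continuous_L2[OF M w]] by (simp add: set_integrable_def)
  have "pw_continuous M (\<eta> N)" for N
  proof (rule pw_continuousI)
    have "Ck_on 0 UNIV (\<eta> N)" using smooth unfolding smooth_on_def by blast
    then show "continuous_on UNIV (\<eta> N)" by simp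
  qed
  then have intN: "integrable lborel (\<lambda>x. indicator (Om M) x *\<^sub>R (f x \<bullet> (\<eta> N x *\<^sub>R w x)))" for N
    using L2_inner_integrable[OF f pw_continuous_L2[OF M pw_continuous_scaleR[OF _ w]]]
    by (simp add: set_integrable_def)
  show ?thesis
    unfolding ip_def set_lebesgue_integral_def
  proof (rule integral_dominated_convergence[where w="\<lambda>x. norm (indicator (Om M) x *\<^sub>R (f x \<bullet> w x))"])
    show "AE x in lborel. (\<lambda>N. indicator (Om M) x *\<^sub>R (f x \<bullet> (\<eta> N x *\<^sub>R w x)))
        \<longlonglongrightarrow> indicator (Om M) x *\<^sub>R (f x \<bullet> w x)"
    proof (rule AE_I2)
      fix x
      show "(\<lambda>N. indicator (Om M) x *\<^sub>R (f x \<bullet> (\<eta> N x *\<^sub>R w x)))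
        \<longlonglongrightarrow> indicator (Om M) x *\<^sub>R (f x \<bullet> w x)"
      proof (cases "x \<in> Om M")
        case True
        have "(\<lambda>N. \<eta> N x * (f x \<bullet> w x)) \<longlonglongrightarrow> 1 * (f x \<bullet> w x)"
          by (intro tendsto_mult lim[OF True] tendsto_const)
        then show ?thesis using True by simp
      qed simp
    qed
    show "AE x in lborel. norm (indicator (Om M) x *\<^sub>R (f x \<bullet> (\<eta> N x *\<^sub>R w x)))
        \<le> norm (indicator (Om M) x *\<^sub>R (f x \<bullet> w x))" for N
    proof (rule AE_I2)
      fix x
      have "\<bar>\<eta> N x\<bar> * \<bar>f x \<bullet> w x\<bar> \<le> 1 * \<bar>f x \<bullet> w x\<bar>"
        by (rule mult_right_mono[OF bound]) simp
      then show "norm (indicator (Om M) x *\<^sub>R (f x \<bullet> (\<eta> N x *\<^sub>R w x)))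
        \<le> norm (indicator (Om M) x *\<^sub>R (f x \<bullet> w x))"
        by (cases "x \<in> Om M") (simp_all add: abs_mult)
    qed
  qed (fact borel_measurable_integrable[OF int] borel_measurable_integrable[OF intN] integrable_norm[OF int])+
qed

text \<open>The weak and the cell-wise derivative have the same pairing with \<open>\<eta>\<^sub>N w\<close> (or \<open>\<eta>\<^sub>N a\<close>), which is a test
  function up to periodic continuation, and \<open>\<eta>\<^sub>N \<rightarrow> 1\<close> on \<open>\<Omega>\<close>.\<close>

lemma
  fixes a :: sfield and w :: vfield
  assumes M: "fe_mesh M"
    and a: "smooth_on (Om M) a" "pw_continuous M a" "pw_continuous M (gradh M a)"
    and w: "smooth_on (Om M) w" "pw_continuous M w" "pw_continuous M (divh M w)"
  shows ip_weak_grad: "weak_grad M a g \<Longrightarrow> ip M g w = ip M (gradh M a) w"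
    and ip_weak_div: "weak_div M w d \<Longrightarrow> ip M d a = ip M (divh M w) a"
proof -
  obtain \<eta> :: "nat \<Rightarrow> sfield" where \<eta>: "\<And>N. smooth_on UNIV (\<eta> N)"
    "\<And>N. \<exists>C. compact C \<and> C \<subseteq> Om M \<and> (\<forall>x. x \<notin> C \<longrightarrow> \<eta> N x = 0)"
    "\<And>N x. \<bar>\<eta> N x\<bar> \<le> 1" "\<And>x. x \<in> Om M \<Longrightarrow> (\<lambda>N. \<eta> N x) \<longlonglongrightarrow> 1"
    using smooth_cutoffs[OF open_Om[OF M]] by metis
  have "\<exists>C. \<forall>N. compact (C N) \<and> C N \<subseteq> Om M \<and> (\<forall>x. x \<notin> C N \<longrightarrow> \<eta> N x = 0)"
    using \<eta>(2) by (intro choice allI)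
  then obtain C where C: "\<And>N. compact (C N)" "\<And>N. C N \<subseteq> Om M" "\<And>N x. x \<notin> C N \<Longrightarrow> \<eta> N x = 0"
    by blast
  have etaC: "Ck_on k UNIV (\<eta> N)" for k N using \<eta>(1) unfolding smooth_on_def by blast
  have ext: "Ck_on k UNIV (\<lambda>x. \<eta> N x *\<^sub>R v x)" if "smooth_on (Om M) v" for k N and v :: "R3 \<Rightarrow> 'z::real_normed_vector"
    using that Ck_on_cutoff_extend[OF open_Om[OF M] _ etaC C] unfolding smooth_on_def by blast
  {
    assume g: "weak_grad M a g"
    have "ip M g (\<lambda>x. \<eta> N x *\<^sub>R w x) = ip M (gradh M a) (\<lambda>x. \<eta> N x *\<^sub>R w x)" for N
    proof -
      let ?f = "\<lambda>x. \<eta> N x *\<^sub>R w x"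
      have sm: "smooth_on UNIV ?f" unfolding smooth_on_def using ext[OF w(1)] by blast
      have supp: "?f x = 0" if "x \<notin> C N" for x using C(3)[OF that] by simp
      obtain \<psi> where \<psi>: "test_fun M \<psi>" "\<And>x. x \<in> Om M \<Longrightarrow> \<psi> x = ?f x"
        using test_fun_extension[OF M sm C(1,2) supp] by metis
      have "divh M ?f x = divh M \<psi> x" if "x \<in> Om M" for x
        by (rule divh_cong[OF M that _ C1_differentiable[OF ext[OF w(1)] UNIV_I]]) (simp add: \<psi>(2))
      then have "ip M a (divh M ?f) = ip M a (divh M \<psi>)" by (intro ip_cong[OF M]) simp
      also have "\<dots> = - ip M g \<psi>" using g \<psi>(1) unfolding weak_grad_def by blast
      also have "ip M g \<psi> = ip M g ?f" by (intro ip_cong[OF M]) (simp add: \<psi>(2))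
      finally show ?thesis using green_cutoff(1)[OF M a w \<eta>(1) C] by simp
    qed
    then have "(\<lambda>N. ip M g (\<lambda>x. \<eta> N x *\<^sub>R w x)) \<longlonglongrightarrow> ip M (gradh M a) w"
      using ip_cutoff_tendsto[OF M pw_continuous_L2[OF M a(3)] w(2) \<eta>(1,3,4)] by simp
    moreover have "(\<lambda>N. ip M g (\<lambda>x. \<eta> N x *\<^sub>R w x)) \<longlonglongrightarrow> ip M g w"
      using g by (intro ip_cutoff_tendsto[OF M _ w(2) \<eta>(1,3,4)]) (simp_all add: weak_grad_def)
    ultimately show "ip M g w = ip M (gradh M a) w" by (rule LIMSEQ_unique[rotated])
  }
  {
    assume d: "weak_div M w d"
    have "ip M d (\<lambda>x. \<eta> N x *\<^sub>R a x) = ip M (divh M w) (\<lambda>x. \<eta> N x *\<^sub>R a x)" for N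
    proof -
      let ?f = "\<lambda>x. \<eta> N x *\<^sub>R a x"
      have sm: "smooth_on UNIV ?f" unfolding smooth_on_def using ext[OF a(1)] by blast
      have supp: "?f x = 0" if "x \<notin> C N" for x using C(3)[OF that] by simp
      obtain \<psi> where \<psi>: "test_fun M \<psi>" "\<And>x. x \<in> Om M \<Longrightarrow> \<psi> x = ?f x"
        using test_fun_extension[OF M sm C(1,2) supp] by metis
      have "gradh M ?f x = gradh M \<psi> x" if "x \<in> Om M" for x
        by (rule gradh_cong[OF M that _ C1_differentiable[OF ext[OF a(1)] UNIV_I]]) (simp add: \<psi>(2))
      then have "ip M w (gradh M ?f) = ip M w (gradh M \<psi>)" by (intro ip_cong[OF M]) simp
      also have "\<dots> = - ip M d \<psi>" using d \<psi>(1) unfolding weak_div_def by blast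
      also have "ip M d \<psi> = ip M d ?f" by (intro ip_cong[OF M]) (simp add: \<psi>(2))
      finally show ?thesis using green_cutoff(2)[OF M a w \<eta>(1) C] by simp
    qed
    then have "(\<lambda>N. ip M d (\<lambda>x. \<eta> N x *\<^sub>R a x)) \<longlonglongrightarrow> ip M (divh M w) a"
      using ip_cutoff_tendsto[OF M pw_continuous_L2[OF M w(3)] a(2) \<eta>(1,3,4)] by simp
    moreover have "(\<lambda>N. ip M d (\<lambda>x. \<eta> N x *\<^sub>R a x)) \<longlonglongrightarrow> ip M d a"
      using d by (intro ip_cutoff_tendsto[OF M _ a(2) \<eta>(1,3,4)]) (simp_all add: weak_div_def)
    ultimately show "ip M d a = ip M (divh M w) a" by (rule LIMSEQ_unique[rotated])
  }
qed

lemma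
  assumes M: "fe_mesh M" and V: "fe_space M V" "u \<in> V"
  shows fe_space_smooth: "smooth_on (Om M) u"
    and fe_space_pw_continuous: "pw_continuous M u"
    and fe_space_zero: "x \<notin> Om M \<Longrightarrow> u x = 0"
proof -
  from V obtain N :: nat and b c where
    b: "\<And>i. i < N \<Longrightarrow> cellwise_smooth M (b i)" "\<And>i x. i < N \<Longrightarrow> x \<notin> Om M \<Longrightarrow> b i x = 0"
    and u: "u = (\<lambda>x. \<Sum>i<N. c i *\<^sub>R b i x)"
    unfolding fe_space_def by blast
  show "u x = 0" if "x \<notin> Om M" using b(2) that by (simp add: u)
  have ext: "\<exists>U g. open U \<and> closure K \<subseteq> U \<and> smooth_on U g \<and> (\<forall>x\<in>K. b i x = g x)"
    if "i < N" "K \<in> cells M" for i K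
    using b(1)[OF that(1)] that(2) unfolding cellwise_smooth_def by blast
  have "pw_continuous M (b i)" if i: "i < N" for i
    unfolding pw_continuous_def
  proof
    fix K assume K: "K \<in> cells M"
    obtain U g where g: "closure K \<subseteq> U" "smooth_on U g" "\<forall>x\<in>K. b i x = g x"
      using ext[OF i K] by blast
    have "Ck_on 0 U g" using g(2) unfolding smooth_on_def by blast
    then have "continuous_on (closure K) g" using g(1) continuous_on_subset[of U g] by simp
    then show "\<exists>g. continuous_on (closure K) g \<and> (\<forall>x\<in>K. b i x = g x)" using g(3) by blast
  qed
  then show "pw_continuous M u"
    unfolding u
    by (intro pw_continuous_sum pw_continuous_linear[OF bounded_linear_scaleR_right]) auto
  have bC: "Ck_on k (Om M) (b i)" if i: "i < N" for i k
  proof (rule Ck_on_local)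
    fix x assume "x \<in> Om M"
    then obtain K where K: "K \<in> cells M" "x \<in> K" unfolding Om_def by blast
    obtain U g where g: "closure K \<subseteq> U" "smooth_on U g" "\<forall>x\<in>K. b i x = g x"
      using ext[OF i K(1)] by blast
    have "K \<subseteq> U" using g(1) closure_subset by blast
    then have "Ck_on k K g" using g(2) Ck_on_subset[of k U g K] unfolding smooth_on_def by blast
    then have "Ck_on k K (b i)"
      by (rule Ck_on_cong[OF fe_mesh_cellD(1)[OF M K(1)], rotated]) (simp add: g(3))
    then show "\<exists>W. open W \<and> x \<in> W \<and> Ck_on k W (b i)"
      using K(2) fe_mesh_cellD(1)[OF M K(1)] by blast
  qed
  have "Ck_on k (Om M) (\<lambda>x. \<Sum>i<n. c i *\<^sub>R b i x)" if "n \<le> N" for k n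
    using that
  proof (induction n)
    case 0
    show ?case using Ck_on_const[OF open_Om[OF M], of k 0] by (simp del: Ck_on.simps)
  next
    case (Suc n)
    have "Ck_on k (Om M) (\<lambda>x. (\<Sum>i<n. c i *\<^sub>R b i x) + c n *\<^sub>R b n x)"
      by (rule Ck_on_add[OF open_Om[OF M] Suc.IH
            Ck_on_linear[OF open_Om[OF M] bounded_linear_scaleR_right bC]]) (use Suc.prems in auto)
    then show ?case by (simp del: Ck_on.simps)
  qed
  then show "smooth_on (Om M) u" unfolding u smooth_on_def by blast
qed

section \<open>Differentiable curves in finite-dimensional spaces of fields\<close>

text \<open>A set with this property is empty or a linear subspace.\<close>

definition lincomb_closed :: "('x \<Rightarrow> 'a::real_vector) set \<Rightarrow> bool" where
  "lincomb_closed S \<longleftrightarrow> (\<forall>u\<in>S. \<forall>v\<in>S. \<forall>r s. (\<lambda>x. r *\<^sub>R u x + s *\<^sub>R v x) \<in> S)"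

lemma lincomb_closedD:
  "lincomb_closed S \<Longrightarrow> u \<in> S \<Longrightarrow> v \<in> S \<Longrightarrow> (\<lambda>x. r *\<^sub>R u x + s *\<^sub>R v x) \<in> S"
  unfolding lincomb_closed_def by blast

lemma lincomb_closed_zero:
  assumes "lincomb_closed S" "u \<in> S"
  shows "(\<lambda>x. 0) \<in> S"
  using lincomb_closedD[OF assms(1,2,2), of 0 0] by simp

lemma lincomb_closed_scaleR:
  assumes "lincomb_closed S" "u \<in> S"
  shows "(\<lambda>x. r *\<^sub>R u x) \<in> S"
  using lincomb_closedD[OF assms(1,2,2), of r 0] by simp

lemma lincomb_closed_sum:
  assumes "lincomb_closed S" "u \<in> S" "\<And>j. j < m \<Longrightarrow> \<beta> j \<in> S"
  shows "(\<lambda>x. \<Sum>j<(m::nat). c j *\<^sub>R \<beta> j x) \<in> S"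
  using assms(3)
proof (induction m)
  case 0
  then show ?case using lincomb_closed_zero[OF assms(1,2)] by simp
next
  case (Suc m)
  have "(\<lambda>x. 1 *\<^sub>R (\<Sum>j<m. c j *\<^sub>R \<beta> j x) + c m *\<^sub>R \<beta> m x) \<in> S"
    by (rule lincomb_closedD[OF assms(1) Suc.IH]) (use Suc.prems in simp_all)
  then show ?case by simp
qed

text \<open>Induction on \<open>N\<close>. The elements of \<open>S\<close> that need only the first \<open>N\<close> functions form a subspace \<open>S'\<close>, which has an
  interpolation operator \<open>P\<close>. If \<open>r \<in> S - S'\<close>, then \<open>r - P r\<close> is nonzero at some \<open>z\<close>, and \<open>S\<close> is spanned
  by \<open>S'\<close> and \<open>r - P r\<close>. So the value of \<open>u - P u\<close> at \<open>z\<close> determines the missing coordinate of \<open>u\<close>; it is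
  again a combination of point values of \<open>u\<close>.\<close>

lemma interpolation_exists:
  fixes S :: "('x \<Rightarrow> 'a::real_inner) set" and b :: "nat \<Rightarrow> 'x \<Rightarrow> 'a"
  assumes "lincomb_closed S" "\<And>u. u \<in> S \<Longrightarrow> \<exists>c. u = (\<lambda>x. \<Sum>i<N. c i *\<^sub>R b i x)"
  shows "\<exists>(m::nat) y e \<beta>. (\<forall>j<m. \<beta> j \<in> S) \<and>
    (\<forall>u\<in>S. u = (\<lambda>x. \<Sum>j<m. (u (y j) \<bullet> e j) *\<^sub>R \<beta> j x))"
  using assms
proof (induction N arbitrary: S)
  case 0
  then have "\<forall>u\<in>S. u = (\<lambda>x. 0)" by auto
  then show ?case by (intro exI[of _ "0::nat"]) auto
next
  case (Suc N)
  define S' where "S' = {u \<in> S. \<exists>c. u = (\<lambda>x. \<Sum>i<N. c i *\<^sub>R b i x)}"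
  have S'_closed: "lincomb_closed S'"
    unfolding lincomb_closed_def
  proof (intro ballI allI)
    fix u v r s assume uv: "u \<in> S'" "v \<in> S'"
    then obtain c d where "u = (\<lambda>x. \<Sum>i<N. c i *\<^sub>R b i x)" "v = (\<lambda>x. \<Sum>i<N. d i *\<^sub>R b i x)"
      unfolding S'_def by blast
    then have "(\<lambda>x. r *\<^sub>R u x + s *\<^sub>R v x) = (\<lambda>x. \<Sum>i<N. (r * c i + s * d i) *\<^sub>R b i x)"
      by (simp add: scaleR_sum_right sum.distrib scaleR_left_distrib)
    moreover have "(\<lambda>x. r *\<^sub>R u x + s *\<^sub>R v x) \<in> S"
      using lincomb_closedD[OF Suc.prems(1)] uv unfolding S'_def by blast
    ultimately show "(\<lambda>x. r *\<^sub>R u x + s *\<^sub>R v x) \<in> S'"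
      unfolding S'_def mem_Collect_eq by (intro conjI exI)
  qed
  have "\<exists>(m::nat) y e \<beta>. (\<forall>j<m. \<beta> j \<in> S') \<and>
      (\<forall>u\<in>S'. u = (\<lambda>x. \<Sum>j<m. (u (y j) \<bullet> e j) *\<^sub>R \<beta> j x))"
    by (rule Suc.IH[OF S'_closed]) (simp add: S'_def)
  then obtain m :: nat and y e \<beta> where \<beta>: "\<And>j. j < m \<Longrightarrow> \<beta> j \<in> S'"
    and rep: "\<And>u. u \<in> S' \<Longrightarrow> u = (\<lambda>x. \<Sum>j<m. (u (y j) \<bullet> e j) *\<^sub>R \<beta> j x)"
    by blast
  show ?case
  proof (cases "S' = S")
    case True
    then show ?thesis using \<beta> rep by blast
  next
    case False
    then obtain r where r: "r \<in> S" "r \<notin> S'" unfolding S'_def by blast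
    obtain c where c: "r = (\<lambda>x. \<Sum>i<Suc N. c i *\<^sub>R b i x)" using Suc.prems(2)[OF r(1)] by blast
    have cN: "c N \<noteq> 0"
    proof
      assume "c N = 0"
      then have "r = (\<lambda>x. \<Sum>i<N. c i *\<^sub>R b i x)" using c by simp
      then show False using r unfolding S'_def by blast
    qed
    define P where "P u x = (\<Sum>j<m. (u (y j) \<bullet> e j) *\<^sub>R \<beta> j x)" for u x
    have "(\<lambda>x. 0) \<in> S"
      using lincomb_closed_zero[OF Suc.prems(1) r(1)] .
    moreover have "(\<lambda>x. 0) = (\<lambda>x. \<Sum>i<N. (\<lambda>i. 0) i *\<^sub>R b i x)" by simp
    ultimately have zero: "(\<lambda>x. 0) \<in> S'" unfolding S'_def mem_Collect_eq by (intro conjI exI)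
    have PS': "P u \<in> S'" for u
      unfolding P_def[abs_def] by (rule lincomb_closed_sum[OF S'_closed zero \<beta>])
    define r0 where "r0 x = r x - P r x" for x
    have "\<exists>z. r0 z \<noteq> 0"
    proof (rule ccontr)
      assume "\<not> (\<exists>z. r0 z \<noteq> 0)"
      then have "r = P r" by (auto simp: r0_def)
      then show False using PS'[of r] r(2) by simp
    qed
    then obtain z where z: "r0 z \<noteq> 0" by blast
    define k where "k = r0 z \<bullet> r0 z"
    have k: "k \<noteq> 0" using z by (simp add: k_def)
    define \<beta>0 where "\<beta>0 x = (1 / k) *\<^sub>R r0 x" for x
    have r0S: "r0 \<in> S"
    proof -
      have "P r \<in> S" using PS' unfolding S'_def by blast
      from lincomb_closedD[OF Suc.prems(1) r(1) this, of 1 "-1"] show ?thesis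
        by (simp add: r0_def[abs_def])
    qed
    have b0S: "\<beta>0 \<in> S"
      unfolding \<beta>0_def[abs_def] by (rule lincomb_closed_scaleR[OF Suc.prems(1) r0S])
    define \<beta>' where "\<beta>' j x = (if j < m then \<beta> j x - (\<beta> j z \<bullet> r0 z) *\<^sub>R \<beta>0 x else \<beta>0 x)" for j x
    define y' where "y' j = (if j < m then y j else z)" for j
    define e' where "e' j = (if j < m then e j else r0 z)" for j
    have "\<beta>' j \<in> S" for j
    proof (cases "j < m")
      case True
      then have "\<beta> j \<in> S" using \<beta> unfolding S'_def by blast
      from lincomb_closedD[OF Suc.prems(1) this b0S, of 1 "- (\<beta> j z \<bullet> r0 z)"] True show ?thesis
        by (simp add: \<beta>'_def[abs_def])
    next
      case False
      then show ?thesis using b0S by (simp add: \<beta>'_def[abs_def])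
    qed
    moreover have "u x = (\<Sum>j<Suc m. (u (y' j) \<bullet> e' j) *\<^sub>R \<beta>' j x)" if u: "u \<in> S" for u x
    proof -
      obtain d where d: "u = (\<lambda>x. \<Sum>i<Suc N. d i *\<^sub>R b i x)" using Suc.prems(2)[OF u] by blast
      define t where "t = d N / c N"
      define v where "v x = 1 *\<^sub>R u x + (- t) *\<^sub>R r x" for x
      have "v = (\<lambda>x. \<Sum>i<N. (d i - t * c i) *\<^sub>R b i x)"
      proof
        fix x
        have "v x = (\<Sum>i<N. d i *\<^sub>R b i x) + d N *\<^sub>R b N x
            - t *\<^sub>R ((\<Sum>i<N. c i *\<^sub>R b i x) + c N *\<^sub>R b N x)"
          unfolding v_def d c by simp
        also have "\<dots> = (\<Sum>i<N. (d i - t * c i) *\<^sub>R b i x)"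
          using cN by (simp add: t_def scaleR_right_distrib scaleR_sum_right scaleR_left_diff_distrib
              sum_subtractf)
        finally show "v x = (\<Sum>i<N. (d i - t * c i) *\<^sub>R b i x)" .
      qed
      moreover have "v \<in> S"
        unfolding v_def[abs_def] by (rule lincomb_closedD[OF Suc.prems(1) u r(1)])
      ultimately have "v \<in> S'" unfolding S'_def mem_Collect_eq by (intro conjI exI)
      then have Pv: "P v x = v x" for x using rep[of v] unfolding P_def by metis
      have uv: "u x = v x + t *\<^sub>R r x" for x by (simp add: v_def)
      have Pu: "P u x = P v x + t *\<^sub>R P r x" for x
        unfolding P_def uv
        by (simp add: inner_add_left scaleR_left_distrib sum.distrib scaleR_sum_right)
      have res: "u x - P u x = t *\<^sub>R r0 x" for x
        unfolding Pu Pv r0_def uv by (simp add: scaleR_diff_right)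
      have "(u z - P u z) \<bullet> r0 z = t * k" unfolding res k_def by simp
      then have t: "t *\<^sub>R r0 x = ((u z - P u z) \<bullet> r0 z) *\<^sub>R \<beta>0 x" using k by (simp add: \<beta>0_def)
      have "(\<Sum>j<Suc m. (u (y' j) \<bullet> e' j) *\<^sub>R \<beta>' j x)
          = (\<Sum>j<m. (u (y j) \<bullet> e j) *\<^sub>R (\<beta> j x - (\<beta> j z \<bullet> r0 z) *\<^sub>R \<beta>0 x)) + (u z \<bullet> r0 z) *\<^sub>R \<beta>0 x"
        by (simp add: y'_def e'_def \<beta>'_def)
      also have "\<dots> = P u x - (P u z \<bullet> r0 z) *\<^sub>R \<beta>0 x + (u z \<bullet> r0 z) *\<^sub>R \<beta>0 x"
        unfolding P_def
        by (simp add: scaleR_diff_right sum_subtractf inner_sum_left scaleR_sum_left)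
      also have "\<dots> = P u x + t *\<^sub>R r0 x"
        unfolding t by (simp add: inner_diff_left scaleR_left_diff_distrib)
      also have "\<dots> = u x" using res[of x] by (simp add: algebra_simps)
      finally show ?thesis by simp
    qed
    ultimately have "(\<forall>j<Suc m. \<beta>' j \<in> S) \<and>
        (\<forall>u\<in>S. u = (\<lambda>x. \<Sum>j<Suc m. (u (y' j) \<bullet> e' j) *\<^sub>R \<beta>' j x))"
      by (intro conjI allI impI ballI ext)
    then show ?thesis
      by (rule exI[of _ "Suc m", OF exI[of _ y', OF exI[of _ e', OF exI[of _ \<beta>']]]])
  qed
qed

text \<open>A curve of scalar fields, on \<open>I\<close> and \<open>\<Omega>\<close>, that is a finite sum of products \<open>a(s) f(x)\<close> with \<open>a\<close>
  differentiable at \<open>t\<close>, together with its time derivative at \<open>t\<close>. The class contains the components of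
  the discrete fields and is closed under products, and differentiation under the integral sign is
  trivial for it.\<close>

inductive field_curve :: "mesh \<Rightarrow> real set \<Rightarrow> real \<Rightarrow> (real \<Rightarrow> sfield) \<Rightarrow> sfield \<Rightarrow> bool"
  for M I t where
  separated: "pw_continuous M f \<Longrightarrow> (a has_real_derivative a') (at t within I) \<Longrightarrow>
    field_curve M I t (\<lambda>s x. a s * f x) (\<lambda>x. a' * f x)"
| add: "field_curve M I t u u' \<Longrightarrow> field_curve M I t v v' \<Longrightarrow>
    field_curve M I t (\<lambda>s x. u s x + v s x) (\<lambda>x. u' x + v' x)"
| cong: "field_curve M I t u u' \<Longrightarrow> (\<And>s x. s \<in> I \<Longrightarrow> x \<in> Om M \<Longrightarrow> v s x = u s x) \<Longrightarrow>
    (\<And>x. x \<in> Om M \<Longrightarrow> v' x = u' x) \<Longrightarrow> field_curve M I t v v'"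

lemma field_curve_const: "pw_continuous M f \<Longrightarrow> field_curve M I t (\<lambda>s. f) (\<lambda>x. 0)"
  using field_curve.separated[of M f "\<lambda>_. 1" 0 t I] by simp

lemma field_curve_sum:
  assumes "finite A" "\<And>i. i \<in> A \<Longrightarrow> field_curve M I t (u i) (u' i)"
  shows "field_curve M I t (\<lambda>s x. \<Sum>i\<in>A. u i s x) (\<lambda>x. \<Sum>i\<in>A. u' i x)"
  using assms
proof (induction A rule: finite_induct)
  case empty
  then show ?case using field_curve_const[OF pw_continuous_const] by simp
next
  case (insert i A)
  then show ?case using field_curve.add[of M I t "u i" "u' i"] by simp
qed

lemma field_curve_mult:
  assumes t: "t \<in> I" and u: "field_curve M I t u u'" and v: "field_curve M I t v v'"
  shows "field_curve M I t (\<lambda>s x. u s x * v s x) (\<lambda>x. u' x * v t x + u t x * v' x)"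
  using u v
proof (induction arbitrary: v v' rule: field_curve.induct)
  case (separated f a a')
  note fa = separated(1,2)
  show ?case
    using separated(3)
  proof (induction rule: field_curve.induct)
    case (separated g b b')
    have "field_curve M I t (\<lambda>s x. (a s * b s) * (f x * g x)) (\<lambda>x. (a' * b t + b' * a t) * (f x * g x))"
      by (rule field_curve.separated[OF pw_continuous_mult[OF fa(1) separated(1)]
            DERIV_mult[OF fa(2) separated(2)]])
    then show ?case
      by (rule field_curve.cong) (simp_all add: algebra_simps)
  next
    case (add v1 v1' v2 v2')
    show ?case
      by (rule field_curve.cong[OF field_curve.add[OF add.IH]]) (simp_all add: algebra_simps)
  next
    case (cong v1 v1' v2 v2')
    show ?case
      by (rule field_curve.cong[OF cong.IH]) (use cong.hyps t in simp_all)
  qed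
next
  case (add u1 u1' u2 u2')
  show ?case
    by (rule field_curve.cong[OF field_curve.add[OF add.IH(1)[OF add.prems] add.IH(2)[OF add.prems]]])
      (simp_all add: algebra_simps)
next
  case (cong u1 u1' u2 u2')
  show ?case
    by (rule field_curve.cong[OF cong.IH[OF cong.prems]]) (use cong.hyps t in simp_all)
qed

lemma field_curve_cmult:
  assumes "t \<in> I" "field_curve M I t u u'"
  shows "field_curve M I t (\<lambda>s x. c * u s x) (\<lambda>x. c * u' x)"
  using field_curve_mult[OF assms(1) field_curve_const[OF pw_continuous_const] assms(2), of c] by simp

lemma field_curve_integral:
  assumes M: "fe_mesh M" and t: "t \<in> I" and u: "field_curve M I t u u'"
  shows "((\<lambda>s. LINT x:Om M|lborel. u s x) has_real_derivative (LINT x:Om M|lborel. u' x))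
      (at t within I)"
proof -
  have "(\<forall>s\<in>I. pw_continuous M (u s)) \<and> pw_continuous M u' \<and>
    ((\<lambda>s. LINT x:Om M|lborel. u s x) has_real_derivative (LINT x:Om M|lborel. u' x)) (at t within I)"
    using u
  proof (induction rule: field_curve.induct)
    case (separated f a a')
    have "((\<lambda>s. a s * (LINT x:Om M|lborel. f x)) has_real_derivative
        a' * (LINT x:Om M|lborel. f x)) (at t within I)"
      by (rule DERIV_cmult_right[OF separated(2)])
    then have "((\<lambda>s. LINT x:Om M|lborel. a s * f x) has_real_derivative
        (LINT x:Om M|lborel. a' * f x)) (at t within I)"
      by simp
    then show ?case
      using pw_continuous_mult[OF pw_continuous_const separated(1)] by simp
  next
    case (add u u' v v')
    have pw: "\<forall>s\<in>I. pw_continuous M (u s)" "\<forall>s\<in>I. pw_continuous M (v s)"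
      "pw_continuous M u'" "pw_continuous M v'" using add.IH by blast+
    note int = pw_continuous_integrable[OF M]
    have "((\<lambda>s. (LINT x:Om M|lborel. u s x) + (LINT x:Om M|lborel. v s x)) has_real_derivative
        (LINT x:Om M|lborel. u' x) + (LINT x:Om M|lborel. v' x)) (at t within I)"
      using add.IH by (intro DERIV_add) simp_all
    moreover have "(LINT x:Om M|lborel. u s x) + (LINT x:Om M|lborel. v s x)
        = (LINT x:Om M|lborel. u s x + v s x)" if "s \<in> I" for s
      using set_integral_add(2)[OF int[OF pw(1)[rule_format, OF that]] int[OF pw(2)[rule_format, OF that]]]
      by simp
    moreover have "(LINT x:Om M|lborel. u' x) + (LINT x:Om M|lborel. v' x)
        = (LINT x:Om M|lborel. u' x + v' x)"
      using set_integral_add(2)[OF int[OF pw(3)] int[OF pw(4)]] by simp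
    ultimately have "((\<lambda>s. LINT x:Om M|lborel. u s x + v s x) has_real_derivative
        (LINT x:Om M|lborel. u' x + v' x)) (at t within I)"
      using has_field_derivative_transform_within[OF _ zero_less_one t, of
          "\<lambda>s. (LINT x:Om M|lborel. u s x) + (LINT x:Om M|lborel. v s x)" _
          "\<lambda>s. LINT x:Om M|lborel. u s x + v s x"] by simp
    then show ?case using pw by (simp add: pw_continuous_add)
  next
    case (cong u u' v v')
    have "(LINT x:Om M|lborel. u s x) = (LINT x:Om M|lborel. v s x)" if "s \<in> I" for s
      by (rule set_lebesgue_integral_cong[OF Om_borel[OF M]]) (use cong.hyps(2) that in simp)
    moreover have "(LINT x:Om M|lborel. u' x) = (LINT x:Om M|lborel. v' x)"
      by (rule set_lebesgue_integral_cong[OF Om_borel[OF M]]) (use cong.hyps(3) in simp)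
    ultimately have "((\<lambda>s. LINT x:Om M|lborel. v s x) has_real_derivative
        (LINT x:Om M|lborel. v' x)) (at t within I)"
      using has_field_derivative_transform_within[OF _ zero_less_one t, of
          "\<lambda>s. LINT x:Om M|lborel. u s x" _ "\<lambda>s. LINT x:Om M|lborel. v s x"] cong.IH by simp
    moreover have "pw_continuous M (v s)" if "s \<in> I" for s
      by (rule pw_continuous_cong[of M "u s"]) (use cong.IH cong.hyps(2) that in simp_all)
    moreover have "pw_continuous M v'"
      by (rule pw_continuous_cong[of M u']) (use cong.IH cong.hyps(3) in simp_all)
    ultimately show ?case by simp
  qed
  then show ?thesis by blast
qed

text \<open>By interpolation \<open>u(s) = (\<Sum>j. (u(s)(y\<^sub>j) \<bullet> e\<^sub>j) \<beta>\<^sub>j)\<close> for all \<open>s \<in> I\<close>, and the coefficients are differentiable at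
  \<open>t\<close> because \<open>u\<close> is so at the nodes \<open>y\<^sub>j\<close>. Nodes outside \<open>\<Omega>\<close>, where nothing is assumed, are harmless:
  finite element fields are zero there.\<close>

lemma ddt_in_space:
  fixes u :: "real \<Rightarrow> R3 \<Rightarrow> 'a::euclidean_space"
  assumes M: "fe_mesh M" and V: "fe_space M V" and S: "S \<subseteq> V" "lincomb_closed S"
    and diff: "time_differentiable M I u" and u: "\<And>s. s \<in> I \<Longrightarrow> u s \<in> S"
    and t: "t \<in> I" "at t within I \<noteq> bot"
  shows "ddt I u t \<in> S" and "field_curve M I t (\<lambda>s x. u s x \<bullet> k) (\<lambda>x. ddt I u t x \<bullet> k)"
proof -
  obtain N :: nat and b where "V = {(\<lambda>x. \<Sum>i<N. c i *\<^sub>R b i x) | c :: nat \<Rightarrow> real. True}"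
    using V unfolding fe_space_def by blast
  then have "\<exists>c. v = (\<lambda>x. \<Sum>i<N. c i *\<^sub>R b i x)" if "v \<in> S" for v
    using subsetD[OF S(1) that] by simp
  from interpolation_exists[OF S(2) this] obtain m :: nat and y e \<beta> where
    \<beta>: "\<And>j. j < m \<Longrightarrow> \<beta> j \<in> S"
    and rep: "\<And>v. v \<in> S \<Longrightarrow> v = (\<lambda>x. \<Sum>j<m. (v (y j) \<bullet> e j) *\<^sub>R \<beta> j x)"
    by blast
  have pw: "pw_continuous M (\<beta> j)" if "j < m" for j
    by (rule fe_space_pw_continuous[OF M V subsetD[OF S(1) \<beta>[OF that]]])
  have deriv: "((\<lambda>s. u s x) has_vector_derivative ddt I u t x) (at t within I)" for x
  proof (cases "x \<in> Om M")
    case True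
    then show ?thesis
      using diff t(1) unfolding time_differentiable_def ddt_def
      by (simp add: vector_derivative_works[symmetric])
  next
    case False
    have "((\<lambda>s. 0) has_vector_derivative 0) (at t within I)" by simp
    then have "((\<lambda>s. u s x) has_vector_derivative 0) (at t within I)"
      by (rule has_vector_derivative_transform_within[OF _ zero_less_one t(1)])
        (use fe_space_zero[OF M V _ False] u S(1) in \<open>simp add: subset_eq\<close>)
    moreover from this have "ddt I u t x = 0"
      unfolding ddt_def by (rule vector_derivative_within[OF t(2)])
    ultimately show ?thesis by simp
  qed
  have coeff: "((\<lambda>s. u s (y j) \<bullet> e j) has_real_derivative (ddt I u t (y j) \<bullet> e j)) (at t within I)" for j
    using bounded_linear.has_vector_derivative[OF bounded_linear_inner_left deriv]
    by (simp add: has_real_derivative_iff_has_vector_derivative)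
  have ddt_rep: "ddt I u t = (\<lambda>x. \<Sum>j<m. (ddt I u t (y j) \<bullet> e j) *\<^sub>R \<beta> j x)"
  proof
    fix x
    have "((\<lambda>s. \<Sum>j<m. (u s (y j) \<bullet> e j) *\<^sub>R \<beta> j x) has_vector_derivative
        (\<Sum>j<m. (ddt I u t (y j) \<bullet> e j) *\<^sub>R \<beta> j x)) (at t within I)"
      by (intro has_vector_derivative_sum
          has_vector_derivative_scaleR[OF coeff has_vector_derivative_const, simplified])
    then have "((\<lambda>s. u s x) has_vector_derivative
        (\<Sum>j<m. (ddt I u t (y j) \<bullet> e j) *\<^sub>R \<beta> j x)) (at t within I)"
      by (rule has_vector_derivative_transform_within[OF _ zero_less_one t(1)])
        (rule fun_cong[OF rep[OF u], symmetric])
    then show "ddt I u t x = (\<Sum>j<m. (ddt I u t (y j) \<bullet> e j) *\<^sub>R \<beta> j x)"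
      unfolding ddt_def[of I u t x] by (rule vector_derivative_within[OF t(2)])
  qed
  show "ddt I u t \<in> S"
    by (subst ddt_rep) (rule lincomb_closed_sum[OF S(2) u[OF t(1)] \<beta>])
  have "field_curve M I t (\<lambda>s x. \<Sum>j<m. (u s (y j) \<bullet> e j) * (\<beta> j x \<bullet> k))
      (\<lambda>x. \<Sum>j<m. (ddt I u t (y j) \<bullet> e j) * (\<beta> j x \<bullet> k))"
  proof (rule field_curve_sum[OF finite_lessThan])
    fix j assume "j \<in> {..<m}"
    then have "pw_continuous M (\<lambda>x. \<beta> j x \<bullet> k)"
      by (intro pw_continuous_inner[OF pw pw_continuous_const]) simp
    then show "field_curve M I t (\<lambda>s x. (u s (y j) \<bullet> e j) * (\<beta> j x \<bullet> k))
        (\<lambda>x. (ddt I u t (y j) \<bullet> e j) * (\<beta> j x \<bullet> k))"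
      by (rule field_curve.separated[OF _ coeff])
  qed
  then show "field_curve M I t (\<lambda>s x. u s x \<bullet> k) (\<lambda>x. ddt I u t x \<bullet> k)"
  proof (rule field_curve.cong)
    show "u s x \<bullet> k = (\<Sum>j<m. (u s (y j) \<bullet> e j) * (\<beta> j x \<bullet> k))" if "s \<in> I" for s x
      using arg_cong[OF fun_cong[OF rep[OF u[OF that]], of x], of "\<lambda>v. v \<bullet> k"]
      by (simp add: inner_sum_left)
    show "ddt I u t x \<bullet> k = (\<Sum>j<m. (ddt I u t (y j) \<bullet> e j) * (\<beta> j x \<bullet> k))" for x
      using arg_cong[OF fun_cong[OF ddt_rep, of x], of "\<lambda>v. v \<bullet> k"]
      by (simp add: inner_sum_left)
  qed
qed

lemma fe_space_lincomb_closed: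
  fixes V :: "(R3 \<Rightarrow> 'a::euclidean_space) set"
  assumes "fe_space M V"
  shows "lincomb_closed V"
proof -
  obtain N :: nat and b where V: "V = {(\<lambda>x. \<Sum>i<N. c i *\<^sub>R b i x) | c :: nat \<Rightarrow> real. True}"
    using assms unfolding fe_space_def by blast
  show ?thesis
    unfolding lincomb_closed_def
  proof (intro ballI allI)
    fix u v r s assume "u \<in> V" "v \<in> V"
    then obtain c d where "u = (\<lambda>x. \<Sum>i<N. c i *\<^sub>R b i x)" "v = (\<lambda>x. \<Sum>i<N. d i *\<^sub>R b i x)"
      unfolding V by blast
    then have "(\<lambda>x. r *\<^sub>R u x + s *\<^sub>R v x) = (\<lambda>x. \<Sum>i<N. (r * c i + s * d i) *\<^sub>R b i x)"
      by (simp add: scaleR_sum_right sum.distrib scaleR_left_distrib)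
    then show "(\<lambda>x. r *\<^sub>R u x + s *\<^sub>R v x) \<in> V" unfolding V by (intro CollectI exI conjI TrueI)
  qed
qed

section \<open>Fields without normal trace\<close>

lemma test_fun_L2:
  assumes "fe_mesh M" "test_fun M \<phi>"
  shows "\<phi> \<in> L2 M"
proof (rule pw_continuous_L2[OF assms(1) pw_continuousI])
  have "Ck_on 0 UNIV \<phi>" using assms(2) unfolding test_fun_def smooth_on_def by blast
  then show "continuous_on UNIV \<phi>" by simp
qed

lemma gradh_test_fun_L2:
  fixes \<phi> :: sfield
  assumes "fe_mesh M" "test_fun M \<phi>"
  shows "gradh M \<phi> \<in> L2 M"
proof (rule pw_continuous_L2[OF assms(1) pw_continuous_gradh])
  show "Ck_on 1 UNIV \<phi>" using assms(2) unfolding test_fun_def smooth_on_def by blast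
qed

text \<open>The trace condition quantifies over all weak divergences of the field, and those of a combination
  are not visibly combinations of those of \<open>u\<close> and \<open>v\<close>. The defect \<open>k\<close> is a weak divergence of zero;
  adding it to a weak divergence of \<open>u\<close> and applying the condition for \<open>u\<close> twice shows that \<open>\<langle>k, \<phi>\<rangle> = 0\<close>.\<close>

lemma ring2_lincomb_closed:
  assumes M: "fe_mesh M" and V2: "fe_space M V2" "V2 \<subseteq> Hdiv M"
  shows "lincomb_closed (ring2 M V2)"
  unfolding lincomb_closed_def
proof (intro ballI allI)
  fix u v :: vfield and r s :: real assume uv: "u \<in> ring2 M V2" "v \<in> ring2 M V2"
  let ?w = "\<lambda>x. r *\<^sub>R u x + s *\<^sub>R v x"
  have V: "u \<in> V2" "v \<in> V2" "zero_normal_trace M u" "zero_normal_trace M v"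
    using uv unfolding ring2_def by blast+
  then have "u \<in> Hdiv M" "v \<in> Hdiv M" using V2(2) by blast+
  then obtain du dv where L: "u \<in> L2 M" "v \<in> L2 M" and d: "weak_div M u du" "weak_div M v dv"
    unfolding Hdiv_def by blast
  have Ld: "du \<in> L2 M" "dv \<in> L2 M" using d unfolding weak_div_def by blast+
  have "zero_normal_trace M ?w"
    unfolding zero_normal_trace_def
  proof (intro allI impI, elim conjE)
    fix d \<phi> g assume dw: "weak_div M ?w d" and \<phi>: "\<phi> \<in> H1 M" "weak_grad M \<phi> g"
    have L': "d \<in> L2 M" "\<phi> \<in> L2 M" "g \<in> L2 M"
      using dw \<phi> unfolding weak_div_def H1_def weak_grad_def by blast+
    define z where "z x = r *\<^sub>R du x + s *\<^sub>R dv x" for x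
    define k where "k x = 1 *\<^sub>R d x + (-1) *\<^sub>R z x" for x
    have Lz: "z \<in> L2 M" unfolding z_def[abs_def] by (rule L2_linear[OF Ld])
    have Lk: "k \<in> L2 M" unfolding k_def[abs_def] by (rule L2_linear[OF L'(1) Lz])
    have kq: "ip M k q = 0" if q: "test_fun M q" for q :: sfield
    proof -
      note Lg = gradh_test_fun_L2[OF M q]
      have Lq: "q \<in> L2 M" by (rule test_fun_L2[OF M q])
      have "ip M d q = - ip M ?w (gradh M q)" using dw q unfolding weak_div_def by simp
      also have "ip M ?w (gradh M q) = r * ip M u (gradh M q) + s * ip M v (gradh M q)"
        by (rule ip_linear_left[OF L Lg])
      also have "\<dots> = - (r * ip M du q + s * ip M dv q)"
        using d q unfolding weak_div_def by (simp add: algebra_simps)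
      also have "r * ip M du q + s * ip M dv q = ip M z q"
        unfolding z_def[abs_def] by (rule ip_linear_left[OF Ld Lq, symmetric])
      finally have "ip M d q = ip M z q" by simp
      then show ?thesis
        unfolding k_def[abs_def] using ip_linear_left[OF L'(1) Lz Lq, of 1 "-1"] by simp
    qed
    have "weak_div M u (\<lambda>x. 1 *\<^sub>R du x + 1 *\<^sub>R k x)"
      unfolding weak_div_def
    proof (intro conjI allI impI)
      show "(\<lambda>x. 1 *\<^sub>R du x + 1 *\<^sub>R k x) \<in> L2 M" by (rule L2_linear[OF Ld(1) Lk])
      fix q :: sfield assume q: "test_fun M q"
      have Lq: "q \<in> L2 M" by (rule test_fun_L2[OF M q])
      show "ip M u (gradh M q) = - ip M (\<lambda>x. 1 *\<^sub>R du x + 1 *\<^sub>R k x) q"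
        using ip_linear_left[OF Ld(1) Lk Lq, of 1 1] kq[OF q] d(1) q unfolding weak_div_def by simp
    qed
    then have "ip M u g + ip M (\<lambda>x. 1 *\<^sub>R du x + 1 *\<^sub>R k x) \<phi> = 0"
      using V(3) \<phi> unfolding zero_normal_trace_def by blast
    moreover have tr: "ip M u g + ip M du \<phi> = 0" "ip M v g + ip M dv \<phi> = 0"
      using V(3,4) \<phi> d unfolding zero_normal_trace_def by blast+
    ultimately have k0: "ip M k \<phi> = 0" using ip_linear_left[OF Ld(1) Lk L'(2), of 1 1] by simp
    have "ip M d \<phi> = r * ip M du \<phi> + s * ip M dv \<phi>"
      using k0 ip_linear_left[OF L'(1) Lz L'(2), of 1 "-1"] ip_linear_left[OF Ld L'(2), of r s]
      unfolding k_def[abs_def] z_def[abs_def] by simp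
    moreover have "ip M ?w g = r * ip M u g + s * ip M v g"
      by (rule ip_linear_left[OF L L'(3)])
    ultimately have "ip M ?w g + ip M d \<phi>
        = r * (ip M u g + ip M du \<phi>) + s * (ip M v g + ip M dv \<phi>)"
      by (simp add: algebra_simps)
    then show "ip M ?w g + ip M d \<phi> = 0" using tr by simp
  qed
  moreover have "?w \<in> V2" by (rule lincomb_closedD[OF fe_space_lincomb_closed[OF V2(1)] V(1,2)])
  ultimately show "?w \<in> ring2 M V2" unfolding ring2_def by blast
qed

section \<open>Terms that vanish for the special test functions\<close>

lemma facet_in_cell_closures:
  assumes M: "fe_mesh M" and e: "e \<in> facets M" and x: "x \<in> face e"
  shows "plus_cell e \<in> cells M" "minus_cell e \<in> cells M"
    "x \<in> closure (plus_cell e)" "x + shift e \<in> closure (minus_cell e)"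
proof -
  have "\<forall>e\<in>facets M.
        plus_cell e \<in> cells M \<and> minus_cell e \<in> cells M \<and> shift e \<in> periods M \<and>
        face e \<noteq> {} \<and> connected (face e) \<and> face e \<subseteq> domain M \<and>
        face e \<in> sets borel \<and> hausdorff2 (face e) < \<infinity> \<and>
        (\<forall>x\<in>face e. \<exists>\<nu>. outward_normal (plus_cell e) x \<nu> \<and>
            outward_normal (minus_cell e) (x + shift e) (- \<nu>))"
    using M unfolding fe_mesh_def by (elim conjE)
  note F = bspec[OF this e]
  show "plus_cell e \<in> cells M" using F by (elim conjE)
  show "minus_cell e \<in> cells M" using F by (elim conjE)
  have "\<forall>x\<in>face e. \<exists>\<nu>. outward_normal (plus_cell e) x \<nu> \<and>
            outward_normal (minus_cell e) (x + shift e) (- \<nu>)"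
    using F by (elim conjE)
  then obtain \<nu> where "outward_normal (plus_cell e) x \<nu>"
    "outward_normal (minus_cell e) (x + shift e) (- \<nu>)"
    using x by blast
  then have "x \<in> frontier (plus_cell e)" "x + shift e \<in> frontier (minus_cell e)"
    unfolding outward_normal_def by simp_all
  then show "x \<in> closure (plus_cell e)" "x + shift e \<in> closure (minus_cell e)"
    by (simp_all add: frontier_def)
qed

text \<open>One-sided limits are only meaningful at limit points of the cell; a facet consists of such points
  since it has an outward normal there.\<close>

lemma trace_zero:
  fixes M :: mesh
  assumes M: "fe_mesh M" and e: "e \<in> facets M" and x: "x \<in> face e"
  shows "trp e (\<lambda>y. 0 :: 'a::euclidean_space) x = 0" "trm e (\<lambda>y. 0 :: 'a) x = 0"
  unfolding trp_def trm_def
  by (rule cell_trace_eq[where g="\<lambda>y. 0"];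
      use facet_in_cell_closures[OF assms] fe_mesh_cellD(1)[OF M] in simp)+

lemma int_Gamma_zero:
  assumes "\<And>e x. e \<in> facets M \<Longrightarrow> x \<in> face e \<Longrightarrow> f e x = 0"
  shows "int_Gamma M f = 0"
  unfolding int_Gamma_def
proof (rule sum.neutral, rule ballI)
  fix e assume e: "e \<in> facets M"
  have "(\<lambda>x. indicator (face e) x *\<^sub>R f e x) = (\<lambda>x. 0)"
    using assms[OF e] by (auto simp: indicator_def)
  then show "(LINT x:face e|surface_measure. f e x) = 0"
    by (simp add: set_lebesgue_integral_def)
qed

lemma pd_const: "pd i (\<lambda>x. c) x = 0"
  by (simp add: pd_def)

lemma curlh_zero: "curlh M (\<lambda>x. 0) = (\<lambda>x. 0)"
  by (rule ext) (simp add: curlh_def pd_const vec_eq_iff forall_3)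

lemma gradh_indicator:
  assumes M: "fe_mesh M"
  shows "gradh M (\<lambda>x. if x \<in> Om M then c else 0) = (\<lambda>x. 0)"
proof
  fix x
  show "gradh M (\<lambda>x. if x \<in> Om M then c else 0) x = 0"
  proof (cases "x \<in> Om M")
    case True
    have "gradh M (\<lambda>x. c) x = gradh M (\<lambda>x. if x \<in> Om M then c else 0) x"
      by (rule gradh_cong[OF M True]) simp_all
    then show ?thesis using True by (simp add: gradh_def pd_const vec_eq_iff)
  next
    case False
    then show ?thesis by (simp add: gradh_def)
  qed
qed

lemma divh_scaleR:
  assumes "x \<in> Om M \<Longrightarrow> w differentiable (at x)"
  shows "divh M (\<lambda>y. c *\<^sub>R w y) x = c * divh M w x"
proof (cases "x \<in> Om M")
  case True
  have D: "(w has_derivative frechet_derivative w (at x)) (at x)"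
    using assms[OF True] by (simp add: frechet_derivative_works)
  have "pd i (\<lambda>y. c *\<^sub>R w y) x = c *\<^sub>R pd i w x" for i
    unfolding pd_eq[OF has_derivative_scaleR_right[OF D]] by (simp add: pd_def)
  then show ?thesis using True by (simp add: divh_def sum_distrib_left)
qed (simp add: divh_def)

text \<open>The trace condition holds for any choice of the weak derivatives; replacing both by the cell-wise ones
  gives integration by parts without a boundary term, and without facet terms.\<close>

lemma zero_normal_trace_green:
  fixes T :: sfield and F :: vfield
  assumes M: "fe_mesh M"
    and T: "smooth_on (Om M) T" "pw_continuous M T" "pw_continuous M (gradh M T)" "T \<in> H1 M"
    and F: "smooth_on (Om M) F" "pw_continuous M F" "pw_continuous M (divh M F)" "F \<in> Hdiv M"
    and tr: "zero_normal_trace M F"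
  shows "ip M F (gradh M T) + ip M (divh M F) T = 0"
proof -
  obtain g where g: "weak_grad M T g" using T(4) unfolding H1_def by blast
  obtain d where d: "weak_div M F d" using F(4) unfolding Hdiv_def by blast
  have "ip M F g + ip M d T = 0"
    using tr d T(4) g unfolding zero_normal_trace_def by blast
  moreover have "ip M F g = ip M F (gradh M T)"
    using ip_weak_grad[OF M T(1-3) F(1-3) g] by (simp add: ip_commute)
  moreover have "ip M d T = ip M (divh M F) T"
    by (rule ip_weak_div[OF M T(1-3) F(1-3) d])
  ultimately show ?thesis by simp
qed

section \<open>The energy balance\<close>

lemma field_curve_norm2:
  fixes u :: "real \<Rightarrow> vfield"
  assumes t: "t \<in> I"
    and u: "\<And>k. field_curve M I t (\<lambda>s x. u s x \<bullet> k) (\<lambda>x. u' x \<bullet> k)"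
  shows "field_curve M I t (\<lambda>s x. (norm (u s x))\<^sup>2) (\<lambda>x. 2 * (u t x \<bullet> u' x))"
proof -
  have "field_curve M I t (\<lambda>s x. \<Sum>k\<in>Basis. (u s x \<bullet> k) * (u s x \<bullet> k))
      (\<lambda>x. \<Sum>k\<in>Basis. (u' x \<bullet> k) * (u t x \<bullet> k) + (u t x \<bullet> k) * (u' x \<bullet> k))"
    by (rule field_curve_sum[OF finite_Basis field_curve_mult[OF t u u]])
  then show ?thesis
  proof (rule field_curve.cong)
    show "(norm (u s x))\<^sup>2 = (\<Sum>k\<in>Basis. (u s x \<bullet> k) * (u s x \<bullet> k))" for s x
      unfolding power2_norm_eq_inner by (rule euclidean_inner)
    show "2 * (u t x \<bullet> u' x) = (\<Sum>k\<in>Basis. (u' x \<bullet> k) * (u t x \<bullet> k) + (u t x \<bullet> k) * (u' x \<bullet> k))" for x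
      by (simp add: euclidean_inner[of "u t x" "u' x"] sum.distrib sum_distrib_left mult.commute)
  qed
qed

lemma energy_derivative:
  assumes M: "fe_mesh M" and dR: "discrete_de_Rham M V0 V1 V2 V3"
    and hydro: "hydro_solution M V0 V2 V3 \<kappa> mi I n V T F B j"
    and mag: "magnetic_solution M V1 V2 mu0 I n F B E j"
    and t: "t \<in> I" "at t within I \<noteq> bot" and mu0: "mu0 \<noteq> 0"
  shows "((\<lambda>s. energy M mi mu0 (n s) (V s) (T s) (B s)) has_real_derivative
      (LINT x:Om M|lborel. mi / 2 * (ddt I n t x * (norm (V t x))\<^sup>2 + n t x * (2 * (V t x \<bullet> ddt I V t x)))
        + (1 / (\<gamma> - 1)) * (ddt I n t x * T t x + n t x * ddt I T t x)
        + (1 / (2 * mu0)) * (2 * (B t x \<bullet> ddt I B t x)))) (at t within I)"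
proof -
  have fe: "fe_space M V0" "fe_space M V2" "fe_space M V3"
    using dR unfolding discrete_de_Rham_def by simp_all
  note lc = fe_space_lincomb_closed
  have diff: "time_differentiable M I n" "time_differentiable M I V" "time_differentiable M I T"
    "time_differentiable M I B"
    using hydro mag unfolding hydro_solution_def magnetic_solution_def by simp_all
  have inn: "n s \<in> V3" and inV: "V s \<in> V2" and inT: "T s \<in> V0" and inB: "B s \<in> V2" if "s \<in> I" for s
    using hydro mag that unfolding hydro_solution_def magnetic_solution_def ring2_def by simp_all
  have n: "field_curve M I t n (ddt I n t)"
    using ddt_in_space(2)[OF M fe(3) subset_refl lc[OF fe(3)] diff(1) inn t, of 1] by simp
  have T: "field_curve M I t T (ddt I T t)"
    using ddt_in_space(2)[OF M fe(1) subset_refl lc[OF fe(1)] diff(3) inT t, of 1] by simp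
  have V: "field_curve M I t (\<lambda>s x. (norm (V s x))\<^sup>2) (\<lambda>x. 2 * (V t x \<bullet> ddt I V t x))"
    by (rule field_curve_norm2[OF t(1) ddt_in_space(2)[OF M fe(2) subset_refl lc[OF fe(2)] diff(2) inV t]])
  have B: "field_curve M I t (\<lambda>s x. (norm (B s x))\<^sup>2) (\<lambda>x. 2 * (B t x \<bullet> ddt I B t x))"
    by (rule field_curve_norm2[OF t(1) ddt_in_space(2)[OF M fe(2) subset_refl lc[OF fe(2)] diff(4) inB t]])
  note curve = field_curve.add[OF field_curve.add[OF
        field_curve_cmult[OF t(1) field_curve_mult[OF t(1) n V], of "mi / 2"]
        field_curve_cmult[OF t(1) field_curve_mult[OF t(1) n T], of "1 / (\<gamma> - 1)"]]
      field_curve_cmult[OF t(1) B, of "1 / (2 * mu0)"]]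
  show ?thesis
    using field_curve_integral[OF M t(1) curve] unfolding energy_def by (simp add: field_simps)
qed

theorem mainTheorem2:
  fixes M :: mesh
    and V0 :: "sfield set" and V1 :: "vfield set" and V2 :: "vfield set" and V3 :: "sfield set"
    and \<kappa> mi mu0 :: real
    and I :: "real set"
    and n T :: "real \<Rightarrow> sfield"
    and V F B E j :: "real \<Rightarrow> vfield"
  assumes "fe_mesh M"
    and "discrete_de_Rham M V0 V1 V2 V3"
    and "mi > 0" and "mu0 > 0"
    and "is_interval I"
    and "hydro_solution M V0 V2 V3 \<kappa> mi I n V T F B j"
    and "magnetic_solution M V1 V2 mu0 I n F B E j"
  shows "\<forall>t\<in>I. ((\<lambda>s. energy M mi mu0 (n s) (V s) (T s) (B s)) has_real_derivative 0) (at t within I)"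
proof
  fix t assume t: "t \<in> I"
  show "((\<lambda>s. energy M mi mu0 (n s) (V s) (T s) (B s)) has_real_derivative 0) (at t within I)"
  proof (cases "at t within I = bot")
    case True
    \<comment> \<open>At an isolated time the derivative within \<open>I\<close> imposes no condition.\<close>
    then show ?thesis by (simp add: has_field_derivative_def has_derivative_def bounded_linear_mult_right)
  next
    case nontrivial: False
    note M = assms(1) and dR = assms(2) and mi = assms(3) and mu0 = assms(4)
      and hydro = assms(6) and mag = assms(7)
    have fe: "fe_space M V0" "fe_space M V1" "fe_space M V2" "fe_space M V3"
      and H: "V0 \<subseteq> H1 M" "V2 \<subseteq> Hdiv M"
      and maps: "gradh M ` V0 \<subseteq> V1" "curlh M ` V1 \<subseteq> V2" "divh M ` V2 \<subseteq> V3"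
      and one: "\<And>c. (\<lambda>x. if x \<in> Om M then c else 0) \<in> V0"
      using dR unfolding discrete_de_Rham_def by simp_all
    have diff: "time_differentiable M I V" "time_differentiable M I T"
      and inV: "\<And>s. s \<in> I \<Longrightarrow> V s \<in> ring2 M V2" and inT: "\<And>s. s \<in> I \<Longrightarrow> T s \<in> V0"
      and nt: "n t \<in> V3" and pos: "\<forall>K\<in>cells M. \<forall>x\<in>closure K. 0 < cell_trace K (n t) x"
      and flux: "flux_eq M V2 (n t) (V t) (F t)"
      and cont: "\<And>x. x \<in> Om M \<Longrightarrow> ddt I n t x + divh M (F t) x = 0"
      and mom: "momentum_eq M V2 mi (n t) (V t) (ddt I V t) (T t) (F t) (B t) (j t)"
      and temp: "temperature_eq M V0 \<kappa> (n t) (T t) (ddt I T t) (F t)"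
      using hydro t unfolding hydro_solution_def by simp_all
    have Bt: "B t \<in> ring2 M V2" and Et: "E t \<in> ring1 M V1" and jt: "j t \<in> ring1 M V1"
      and farad: "\<And>x. x \<in> Om M \<Longrightarrow> ddt I B t x + curlh M (E t) x = 0"
      and ohm: "\<And>S. S \<in> ring1 M V1 \<Longrightarrow> ip M S (\<lambda>x. E t x + (F t x /\<^sub>R n t x) \<times> B t x) = 0"
      and ampere: "\<And>S. S \<in> ring1 M V1 \<Longrightarrow>
        ip M S (j t) = ip M (curlh M S) (\<lambda>x. (1 / mu0) *\<^sub>R B t x)"
      using mag t unfolding magnetic_solution_def by simp_all
    define n1 where "n1 = ddt I n t"
    define V' where "V' = ddt I V t"
    define T' where "T' = ddt I T t"
    define B' where "B' = ddt I B t"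
    note closed2 = ring2_lincomb_closed[OF M fe(3) H(2)]
    have ring2_sub: "ring2 M V2 \<subseteq> V2" and ring1_sub: "ring1 M V1 \<subseteq> V1"
      unfolding ring1_def ring2_def by blast+
    have V'r: "V' \<in> ring2 M V2"
      unfolding V'_def by (rule ddt_in_space(1)[OF M fe(3) ring2_sub closed2 diff(1) inV t nontrivial])
    have T'v: "T' \<in> V0"
      unfolding T'_def
      by (rule ddt_in_space(1)[OF M fe(1) subset_refl fe_space_lincomb_closed[OF fe(1)] diff(2) inT t nontrivial])
    have Fr: "F t \<in> ring2 M V2" using flux unfolding flux_eq_def by blast
    have Fv: "F t \<in> V2" and Vv: "V t \<in> V2" and Bv: "B t \<in> V2" and V'v: "V' \<in> V2"
      using ring2_sub Fr inV[OF t] Bt V'r by blast+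
    have Ev: "E t \<in> V1" and jv: "j t \<in> V1" using ring1_sub Et jt by blast+
    note pw = fe_space_pw_continuous[OF M]
    have pn: "pw_continuous M (n t)" and pV: "pw_continuous M (V t)" and pT: "pw_continuous M (T t)"
      and pB: "pw_continuous M (B t)" and pF: "pw_continuous M (F t)" and pE: "pw_continuous M (E t)"
      and pV': "pw_continuous M V'" and pT': "pw_continuous M T'"
      using pw[OF fe(4) nt] pw[OF fe(3) Vv] pw[OF fe(1) inT[OF t]] pw[OF fe(3) Bv] pw[OF fe(3) Fv]
        pw[OF fe(2) Ev] pw[OF fe(3) V'v] pw[OF fe(1) T'v] .
    have pdF: "pw_continuous M (divh M (F t))" using pw[OF fe(4)] maps(3) Fv by blast
    have pgT: "pw_continuous M (gradh M (T t))" using pw[OF fe(2)] maps(1) inT[OF t] by blast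
    have pcE: "pw_continuous M (curlh M (E t))" using pw[OF fe(3)] maps(2) Ev by blast
    have pX: "pw_continuous M (\<lambda>x. (F t x /\<^sub>R n t x) \<times> B t x)"
      by (rule pw_continuous_cross[OF pw_continuous_scaleR[OF pw_continuous_inverse[OF M pn pos] pF] pB])
    have pj: "pw_continuous M (j t)" by (rule pw[OF fe(2) jv])
    note L2 = pw_continuous_L2[OF M]
    define A1 where "A1 = ip M (\<lambda>x. 1 / 2 * (norm (V t x))\<^sup>2) (divh M (F t))"
    define A2 where "A2 = ip M (\<lambda>x. n t x *\<^sub>R V t x) V'"
    define A3 where "A3 = ip M (divh M (F t)) (T t)"
    define A4 where "A4 = ip M (n t) T'"
    define A5 where "A5 = ip M (curlh M (E t)) (B t)"
    define A6 where "A6 = ip M (F t) (gradh M (T t))"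
    define J where "J = ip M (j t) (\<lambda>x. (F t x /\<^sub>R n t x) \<times> B t x)"
    define G where "G = ip M (\<lambda>x. F t x /\<^sub>R n t x) (gradh M (\<lambda>x. n t x * T t x))"
    define Q where "Q = int_Gamma M (\<lambda>e x. jump e (\<lambda>y. n t y * T t y) x * avg_normal e (\<lambda>y. F t y /\<^sub>R n t y) x)"

    \<comment> \<open>\<open>J\<close> is the exchange of energy with the magnetic field; \<open>G\<close> and \<open>Q\<close> are the pressure terms in the cells and on the facets.\<close>
    have trace: "A6 + A3 = 0"
      unfolding A6_def A3_def
    proof (rule zero_normal_trace_green[OF M fe_space_smooth[OF M fe(1) inT[OF t]] pT pgT _
          fe_space_smooth[OF M fe(3) Fv] pF pdF])
      show "T t \<in> H1 M" "F t \<in> Hdiv M" using H inT[OF t] Fv by blast+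
      show "zero_normal_trace M (F t)" using Fr unfolding ring2_def by blast
    qed

    have em: "A5 / mu0 + J = 0"
    proof -
      have "ip M (\<lambda>x. 1 *\<^sub>R E t x + 1 *\<^sub>R ((F t x /\<^sub>R n t x) \<times> B t x)) (j t) = 0"
        using ohm[OF jt] by (simp add: ip_commute)
      then have "ip M (E t) (j t) + ip M (\<lambda>x. (F t x /\<^sub>R n t x) \<times> B t x) (j t) = 0"
        using ip_linear_left[OF L2[OF pE] L2[OF pX] L2[OF pj], of 1 1] by simp
      then have "ip M (E t) (j t) + J = 0" by (simp add: J_def ip_commute)
      moreover have "ip M (E t) (j t) = A5 / mu0"
        unfolding ampere[OF Et] A5_def by (simp add: ip_def)
      ultimately show ?thesis by simp
    qed

    have mF: "(\<lambda>x. mi *\<^sub>R F t x) \<in> ring2 M V2" by (rule lincomb_closed_scaleR[OF closed2 Fr])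
    have momentum: "mi * A2 - mi * A1 + J + G - Q = 0"
    proof -
      \<comment> \<open>\<open>w = m\<^sub>i F\<close>, so that \<open>w/(m\<^sub>i n) = F/n\<close> and \<open>w \<times> F/n = 0\<close>.\<close>
      have cross0: "(\<lambda>x. (mi *\<^sub>R F t x) \<times> (F t x /\<^sub>R n t x)) = (\<lambda>x. 0)"
        by (simp add: cross_mult_left cross_mult_right)
      have ratio: "(mi *\<^sub>R F t x) /\<^sub>R (mi * n t x) = F t x /\<^sub>R n t x" for x
        using mi by simp
      note pnV = pw_continuous_scaleR[OF pn pV]
      have "ip M (\<lambda>x. F t x - n t x *\<^sub>R V t x) V' = 0"
        using flux V'r unfolding flux_eq_def by (subst ip_commute) simp
      then have "ip M (F t) V' = A2"
        using ip_linear_left[OF L2[OF pF] L2[OF pnV] L2[OF pV'], of 1 "-1"] unfolding A2_def by simp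
      then have m1: "ip M (\<lambda>x. mi *\<^sub>R F t x) V' = mi * A2" by (simp add: ip_def)
      have m2: "ip M (curlh M (\<lambda>x. (mi *\<^sub>R F t x) \<times> (F t x /\<^sub>R n t x))) (V t) = 0"
        unfolding cross0 curlh_zero by (rule ip_zero)
      have m3: "int_Gamma M (\<lambda>e x. jump_cross e (\<lambda>y. (mi *\<^sub>R F t y) \<times> (F t y /\<^sub>R n t y)) x \<bullet> upwind e (V t) x) = 0"
        unfolding cross0 by (rule int_Gamma_zero) (simp add: jump_cross_def trace_zero[OF M])
      have "divh M (\<lambda>x. mi *\<^sub>R F t x) x = mi * divh M (F t) x" for x
      proof (rule divh_scaleR)
        assume x: "x \<in> Om M"
        have "Ck_on 1 (Om M) (F t)" using fe_space_smooth[OF M fe(3) Fv] unfolding smooth_on_def by blast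
        then show "F t differentiable (at x)" using x by simp
      qed
      then have m4: "ip M (\<lambda>x. 1 / 2 * (norm (V t x))\<^sup>2) (divh M (\<lambda>x. mi *\<^sub>R F t x)) = mi * A1"
        unfolding A1_def ip_def by (simp add: mult.left_commute flip: set_integral_mult_right)
      show ?thesis
        using bspec[OF mom[unfolded momentum_eq_def] mF, folded V'_def]
        unfolding m1 m2 m3 m4 ratio unfolding J_def[symmetric] G_def[symmetric] Q_def[symmetric] by simp
    qed

    have temperature: "A4 / (\<gamma> - 1) + A6 / (\<gamma> - 1) - G + Q = 0"
    proof -
      \<comment> \<open>The constant 1 is represented by the indicator of \<open>Om M\<close>; the difference is invisible next to \<open>n\<close> and \<open>F\<close>, which are zero off the cells.\<close>
      let ?q = "\<lambda>x. if x \<in> Om M then 1 else 0 :: real"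
      have n0: "n t x = 0" if "x \<notin> Om M" for x by (rule fe_space_zero[OF M fe(4) nt that])
      have F0: "F t x = 0" if "x \<notin> Om M" for x by (rule fe_space_zero[OF M fe(3) Fv that])
      have q1: "?q x * n t x * T t x = n t x * T t x" for x using n0[of x] by simp
      have q2: "n t x * ?q x / (\<gamma> - 1) = n t x / (\<gamma> - 1)" for x using n0[of x] by simp
      have q3: "(?q x / (\<gamma> - 1)) *\<^sub>R F t x = (1 / (\<gamma> - 1)) *\<^sub>R F t x" for x using F0[of x] by simp
      have t1: "ip M (\<lambda>x. n t x / (\<gamma> - 1)) T' = A4 / (\<gamma> - 1)" by (simp add: A4_def ip_def)
      have t2: "ip M (\<lambda>x. (1 / (\<gamma> - 1)) *\<^sub>R F t x) (gradh M (T t)) = A6 / (\<gamma> - 1)"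
        by (simp add: A6_def ip_def)
      have t3: "int_Gamma M (\<lambda>e x. (facet_area e)\<^sup>2 * \<kappa> / ((\<gamma> - 1) * avg e (n t) x)
          * jump e (\<lambda>y. F t y \<bullet> gradh M ?q y) x * jump e (\<lambda>y. F t y \<bullet> gradh M (T t) y) x) = 0"
        unfolding gradh_indicator[OF M]
        by (rule int_Gamma_zero) (simp add: jump_def trace_zero[OF M])
      show ?thesis
        using bspec[OF temp[unfolded temperature_eq_def] one[of 1], folded T'_def]
        unfolding q1 q2 q3 t1 t2 t3 unfolding G_def[symmetric] Q_def[symmetric] by simp
    qed

    have "(LINT x:Om M|lborel. mi / 2 * (n1 x * (norm (V t x))\<^sup>2 + n t x * (2 * (V t x \<bullet> V' x)))
        + (1 / (\<gamma> - 1)) * (n1 x * T t x + n t x * T' x)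
        + (1 / (2 * mu0)) * (2 * (B t x \<bullet> B' x)))
      = (LINT x:Om M|lborel.
          - mi * ((1 / 2 * (norm (V t x))\<^sup>2) \<bullet> divh M (F t) x)
          + (mi * ((n t x *\<^sub>R V t x) \<bullet> V' x)
          + (- (1 / (\<gamma> - 1)) * (divh M (F t) x \<bullet> T t x)
          + ((1 / (\<gamma> - 1)) * (n t x \<bullet> T' x)
          + - (1 / mu0) * (curlh M (E t) x \<bullet> B t x)))))"
    proof (rule set_lebesgue_integral_cong[OF Om_borel[OF M]], intro allI impI)
      fix x assume x: "x \<in> Om M"
      have n1: "n1 x = - divh M (F t) x" using cont[OF x] unfolding n1_def by simp
      have B': "B' x = - curlh M (E t) x" using farad[OF x] unfolding B'_def by (simp add: add_eq_0_iff)
      show "mi / 2 * (n1 x * (norm (V t x))\<^sup>2 + n t x * (2 * (V t x \<bullet> V' x)))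
        + (1 / (\<gamma> - 1)) * (n1 x * T t x + n t x * T' x)
        + (1 / (2 * mu0)) * (2 * (B t x \<bullet> B' x))
        = - mi * ((1 / 2 * (norm (V t x))\<^sup>2) \<bullet> divh M (F t) x)
          + (mi * ((n t x *\<^sub>R V t x) \<bullet> V' x)
          + (- (1 / (\<gamma> - 1)) * (divh M (F t) x \<bullet> T t x)
          + ((1 / (\<gamma> - 1)) * (n t x \<bullet> T' x)
          + - (1 / mu0) * (curlh M (E t) x \<bullet> B t x))))"
        unfolding n1 B' by (simp add: algebra_simps inner_commute)
    qed
    also have "\<dots> = - mi * A1 + (mi * A2 + (- (1 / (\<gamma> - 1)) * A3 + ((1 / (\<gamma> - 1)) * A4 + - (1 / mu0) * A5)))"
    proof -
      have pV2: "pw_continuous M (\<lambda>x. 1 / 2 * (norm (V t x))\<^sup>2)"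
        unfolding power2_norm_eq_inner
        by (rule pw_continuous_mult[OF pw_continuous_const pw_continuous_inner[OF pV pV]])
      note int = set_integrable_mult_right[OF pw_continuous_integrable[OF M pw_continuous_inner]]
      note i1 = int[OF pV2 pdF] and i2 = int[OF pw_continuous_scaleR[OF pn pV] pV']
        and i3 = int[OF pdF pT] and i4 = int[OF pn pT'] and i5 = int[OF pcE pB]
      note j4 = set_integral_add(1)[OF i4 i5] note j3 = set_integral_add(1)[OF i3 j4]
      note j2 = set_integral_add(1)[OF i2 j3]
      show ?thesis
        unfolding set_integral_add(2)[OF i1 j2] set_integral_add(2)[OF i2 j3]
          set_integral_add(2)[OF i3 j4] set_integral_add(2)[OF i4 i5] set_integral_mult_right
          A1_def A2_def A3_def A4_def A5_def ip_def by (rule refl)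
    qed
    also have "\<dots> = 0"
    proof -
      have "- mi * A1 + (mi * A2 + (- (1 / (\<gamma> - 1)) * A3 + ((1 / (\<gamma> - 1)) * A4 + - (1 / mu0) * A5)))
        = (mi * A2 - mi * A1 + J + G - Q) + (A4 / (\<gamma> - 1) + A6 / (\<gamma> - 1) - G + Q)
          - (A5 / mu0 + J) - (A6 + A3) / (\<gamma> - 1)"
        by (simp add: add_divide_distrib)
      then show ?thesis unfolding momentum temperature em trace by simp
    qed
    finally show ?thesis
      using energy_derivative[OF M dR hydro mag t nontrivial] mu0
      unfolding n1_def V'_def T'_def B'_def by simp
  qed
qed

end
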